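(* Let $\lambda=(\lambda_1,\lambda_2,\ldots,\lambda_n)$ be an integer partition, let $\boldsymbol{x}=(x_1,\ldots,x_n)$, and let $w\in S_n$. Denote by $\mathcal{S}_w^{\lambda+\rho}$ the system whose grid has $n$ rows and $\lambda_1+n$ columns, and whose boundary condition is determined by the permutation $w$ and the partition $\lambda+\rho$, where $\rho=(n-1,n-2,\ldots,1,0)$. Then $$Z(\mathcal{S}_w^{\lambda+\rho})=\mathcal{KN}_w^{(\alpha,\beta,\gamma)}(\boldsymbol{x};\lambda).$$
   Context: Partitions are weakly decreasing with nonnegative integer parts; $\alpha,\beta,\gamma$ are parameters. Twisted Kirillov polynomials. Let $\partial_i(f)=\dfrac{f(x_1,\ldots,x_{i-1},x_{i+1},x_i,x_{i+2},\ldots,x_n)-f(x_1,\ldots,x_n)}{x_{i+1}-x_i}$ and, for $1\le i\le n-1$, $$T_i^{(\alpha,\beta,\gamma)}=-\beta+\big((\alpha+\beta+\gamma)x_i+\gamma x_{i+1}+1+(\beta+\gamma)(\alpha+\gamma)x_ix_{i+1}\big)\partial_i .$$ These satisfy the braid relations, so $T_w^{(\alpha,\beta,\gamma)}=T_{i_1}^{(\alpha,\beta,\gamma)}\circ\cdots\circ T_{i_\ell}^{(\alpha,\beta,\gamma)}$ is well defined for any reduced decomposition $w=s_{i_1}\cdots s_{i_\ell}\in S_n$. Set $\mathcal{KN}_w^{(\alpha,\beta,\gamma)}(\boldsymbol{x};\lambda)=T_w^{(\alpha,\beta,\gamma)}(x_1^{d_1}\cdots x_n^{d_n})$ with $d_i=\lambda_1-\lambda_{n+1-i}+n-i$.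 Lattice model. For integers $n\ge1$, $N\ge0$, take the rectangular grid with $n$ rows, numbered $1,\ldots,n$ from top to bottom, and $N+1$ columns, numbered $N,N-1,\ldots,0$ from left to right; row $i$ has spectral parameter $x_i$. Vertices are intersections of rows and columns; each has four adjacent edges (west, north, east, south). Horizontal edges are labeled by elements of $\{+,1,\ldots,n\}$ and vertical edges by subsets of $\{1,\ldots,n\}$. A state is a labeling of all edges; its weight is the product of the Boltzmann weights of all vertices. The system of a boundary condition (a labeling of the outer edges) consists of all states with those outer labels, and its partition function $Z$ is the sum of their weights. Boltzmann weights. Let $h_k=h_k(\alpha,\beta)$ be the complete homogeneous symmetric polynomial of degree $k$ in $\alpha,\beta$, with $h_{-1}=0$ and $h_{-2}=-1/(\alpha\beta)$ (so $\alpha\beta h_{-2}=-1$), and for $\Sigma\subseteq\{1,\ldots,n\}$ let $\Sigma_{>c}=\{s\in\Sigma: s\ge c+1\}$. For a vertex in a row with spectral parameter $x$ whose (west, north, east, south) labels are as listed, with colors $c,d\in\{1,\ldots,n\}$, the weight is: (1) $(+,\Sigma,+,\Sigma)$: $(-1)^{|\Sigma|+1}\big(((\alpha+\gamma)(\beta+\gamma)x+\gamma)h_{|\Sigma|-1}+\alpha\beta h_{|\Sigma|-2}\big)$. (2) $(c,\Sigma,c,\Sigma)$: $(1+(\alpha+\beta+\gamma)x)(\alpha\beta)^{|\Sigma_{>c}|}$ if $c\in\Sigma$; $x(\alpha\beta)^{|\Sigma_{>c}|}$ if $c\notin\Sigma$. (3) $(+,\Sigma,c,\Sigma\cup\{c\})$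 with $c\notin\Sigma$: $(-\alpha)^{|\Sigma_{>c}|}(1+(\alpha+\gamma)x)(1+(\beta+\gamma)x)$. (4) $(c,\Sigma,+,\Sigma\setminus\{c\})$ with $c\in\Sigma$: $(-1)^{|\Sigma|}(-\beta)^{|\Sigma_{>c}|}(\alpha\beta h_{|\Sigma|-3}+\gamma h_{|\Sigma|-2})$. (5) $(c,\Sigma,d,(\Sigma\cup\{d\})\setminus\{c\})$ with $c<d$, $c\in\Sigma$, $d\notin\Sigma$: $(-\alpha)^{|\Sigma_{>d}|}(-\beta)^{|\Sigma_{>c}|}(1+(\alpha+\gamma)x)$. (6) $(d,\Sigma,c,\Sigma')$ with $\Sigma'=(\Sigma\cup\{c\})\setminus\{d\}$, $c<d$, $d\in\Sigma$, $c\notin\Sigma$: $(-\alpha)^{|\Sigma'_{>c}|}(-\beta)^{|\Sigma_{>d}|}(1+(\beta+\gamma)x)$. All other labelings have weight $0$. Boundary conditions. The boundary condition determined by $w\in S_n$ and a partition $\mu=(\mu_1\ge\cdots\ge\mu_n)$ with $\mu_1\le N$: the left boundary edge of row $i$ is labeled $n+1-w^{-1}(i)$; the top boundary edge of column $k$ is labeled by the set $\{i:\mu_i=k\}$; all right boundary edges are labeled $+$; all bottom boundary edges are labeled $\varnothing$. *)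

theory Defs
  imports
    "HOL-Library.Poly_Mapping"
    "HOL-Library.FuncSet"
    "HOL-Combinatorics.Permutations"
begin

section \<open>Polynomials in countably many variables\<close>

text \<open>
  A polynomial in \<open>x\<^sub>0, x\<^sub>1, \<dots>\<close> (only \<open>x\<^sub>1, \<dots>, x\<^sub>n\<close> are used) maps exponent vectors
  to coefficients; multiplication is the convolution product of \<^theory>\<open>HOL-Library.Poly_Mapping\<close>. The parameters \<open>\<alpha>\<close>, \<open>\<beta>\<close>, \<open>\<gamma>\<close> are arbitrary
  elements of the coefficient field; indeterminate parameters are the case of
  a field of rational functions in \<open>\<alpha>\<close>, \<open>\<beta>\<close>, \<open>\<gamma>\<close>.
\<close>

type_synonym 'a xpoly = "(nat \<Rightarrow>\<^sub>0 nat) \<Rightarrow>\<^sub>0 'a"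

definition Const :: "'a::zero \<Rightarrow> 'a xpoly" where
  "Const c = Poly_Mapping.single 0 c"

definition X :: "nat \<Rightarrow> 'a::field xpoly" where
  "X i = Poly_Mapping.single (Poly_Mapping.single i 1) 1"

text \<open>
  The polynomial obtained from \<open>f\<close> by exchanging \<open>x\<^sub>i\<close> and \<open>x\<^bsub>i+1\<^esub>\<close>: the inner \<open>map_key\<close>
  exchanges two entries of an exponent vector, the outer one reindexes the coefficients.
\<close>

definition swap_vars :: "nat \<Rightarrow> 'a::field xpoly \<Rightarrow> 'a xpoly" where
  "swap_vars i f =
     Poly_Mapping.map_key (Poly_Mapping.map_key (transpose i (i + 1))) f"


section \<open>Twisted Kirillov polynomials\<close>

text \<open>
  The exact quotient \<open>(s\<^sub>i f - f) / (x\<^bsub>i+1\<^esub> - x\<^sub>i)\<close>; it exists and is unique, see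
  \<open>divided_difference_ex1\<close> below.
\<close>

definition divided_difference :: "nat \<Rightarrow> 'a::field xpoly \<Rightarrow> 'a xpoly" where
  "divided_difference i f = (THE g. (X (i + 1) - X i) * g = swap_vars i f - f)"

definition T_op :: "'a::field \<Rightarrow> 'a \<Rightarrow> 'a \<Rightarrow> nat \<Rightarrow> 'a xpoly \<Rightarrow> 'a xpoly" where
  "T_op \<alpha> \<beta> \<gamma> i f =
     - Const \<beta> * f +
     (Const (\<alpha> + \<beta> + \<gamma>) * X i + Const \<gamma> * X (i + 1) + 1
        + Const ((\<beta> + \<gamma>) * (\<alpha> + \<gamma>)) * X i * X (i + 1)) * divided_difference i f"

definition word_perm :: "nat list \<Rightarrow> nat \<Rightarrow> nat" where
  "word_perm is = foldr (\<lambda>i p. transpose i (i + 1) \<circ> p) is id"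

definition reduced_word :: "nat \<Rightarrow> (nat \<Rightarrow> nat) \<Rightarrow> nat list \<Rightarrow> bool" where
  "reduced_word n w is \<longleftrightarrow>
     set is \<subseteq> {1..<n} \<and> word_perm is = w \<and>
     (\<forall>js. set js \<subseteq> {1..<n} \<and> word_perm js = w \<longrightarrow> length is \<le> length js)"

definition T_word :: "'a::field \<Rightarrow> 'a \<Rightarrow> 'a \<Rightarrow> nat list \<Rightarrow> 'a xpoly \<Rightarrow> 'a xpoly" where
  "T_word \<alpha> \<beta> \<gamma> is = foldr (\<lambda>i T. T_op \<alpha> \<beta> \<gamma> i \<circ> T) is id"

text \<open>
  The operators \<open>T_op\<close> satisfy the braid relations, so the choice of the reduced word
  is immaterial.
\<close>

definition T_perm ::
    "'a::field \<Rightarrow> 'a \<Rightarrow> 'a \<Rightarrow> nat \<Rightarrow> (nat \<Rightarrow> nat) \<Rightarrow> 'a xpoly \<Rightarrow> 'a xpoly" where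
  "T_perm \<alpha> \<beta> \<gamma> n w = T_word \<alpha> \<beta> \<gamma> (SOME is. reduced_word n w is)"

text \<open>
  Since \<open>\<lambda>\<close> is reserved, the partition is written \<open>lam\<close>; its parts are \<open>lam 1, \<dots>, lam n\<close>.
\<close>

definition is_partition :: "nat \<Rightarrow> (nat \<Rightarrow> nat) \<Rightarrow> bool" where
  "is_partition n lam \<longleftrightarrow> (\<forall>i j. 1 \<le> i \<and> i \<le> j \<and> j \<le> n \<longrightarrow> lam j \<le> lam i)"

definition KN ::
    "'a::field \<Rightarrow> 'a \<Rightarrow> 'a \<Rightarrow> nat \<Rightarrow> (nat \<Rightarrow> nat) \<Rightarrow> (nat \<Rightarrow> nat) \<Rightarrow> 'a xpoly" where
  "KN \<alpha> \<beta> \<gamma> n w lam =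
     T_perm \<alpha> \<beta> \<gamma> n w
       (\<Prod>i = 1..n. X i ^ ((lam 1 - lam (n + 1 - i)) + (n - i)))"


section \<open>The lattice model\<close>

datatype hlabel = Plus | Color nat

definition hsym :: "'a::field \<Rightarrow> 'a \<Rightarrow> int \<Rightarrow> 'a" where
  "hsym \<alpha> \<beta> k =
     (if k \<ge> 0 then (\<Sum>j\<le>nat k. \<alpha> ^ j * \<beta> ^ (nat k - j))
      else if k = -2 then - 1 / (\<alpha> * \<beta>)
      else 0)"

text \<open>
  The product \<open>\<alpha>\<beta>h\<^sub>k\<close>. The value \<open>h\<^bsub>-2\<^esub>\<close> enters the weights only through \<open>\<alpha>\<beta>h\<^bsub>-2\<^esub> = -1\<close>,
  and this convention also covers \<open>\<alpha>\<beta> = 0\<close>, where \<open>h\<^bsub>-2\<^esub>\<close> itself is not defined.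
\<close>

definition ab_hsym :: "'a::field \<Rightarrow> 'a \<Rightarrow> int \<Rightarrow> 'a" where
  "ab_hsym \<alpha> \<beta> k = (if k = -2 then - 1 else \<alpha> * \<beta> * hsym \<alpha> \<beta> k)"

lemma ab_hsym_eq: "\<alpha> * \<beta> \<noteq> 0 \<Longrightarrow> ab_hsym \<alpha> \<beta> k = \<alpha> * \<beta> * hsym \<alpha> \<beta> k"
  by (simp add: ab_hsym_def hsym_def)

definition num_gt :: "nat set \<Rightarrow> nat \<Rightarrow> nat" where
  "num_gt S c = card {s \<in> S. s \<ge> c + 1}"

text \<open>
  The arguments after the spectral parameter \<open>x\<close> are the west, north, east and south labels.
\<close>

fun boltzmann ::
    "'a::field \<Rightarrow> 'a \<Rightarrow> 'a \<Rightarrow> 'a xpoly \<Rightarrow>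
      hlabel \<Rightarrow> nat set \<Rightarrow> hlabel \<Rightarrow> nat set \<Rightarrow> 'a xpoly" where
  "boltzmann \<alpha> \<beta> \<gamma> x Plus S Plus S' =
     (if S' = S then
        (-1) ^ (card S + 1) *
        ((Const ((\<alpha> + \<gamma>) * (\<beta> + \<gamma>)) * x + Const \<gamma>) * Const (hsym \<alpha> \<beta> (int (card S) - 1))
          + Const (ab_hsym \<alpha> \<beta> (int (card S) - 2)))
      else 0)"
| "boltzmann \<alpha> \<beta> \<gamma> x Plus S (Color c) S' =
     (if c \<notin> S \<and> S' = S \<union> {c} then
        Const ((-\<alpha>) ^ num_gt S c) * (1 + Const (\<alpha> + \<gamma>) * x) * (1 + Const (\<beta> + \<gamma>) * x)
      else 0)"
| "boltzmann \<alpha> \<beta> \<gamma> x (Color c) S Plus S' =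
     (if c \<in> S \<and> S' = S - {c} then
        Const ((-1) ^ card S * (-\<beta>) ^ num_gt S c *
          (ab_hsym \<alpha> \<beta> (int (card S) - 3) + \<gamma> * hsym \<alpha> \<beta> (int (card S) - 2)))
      else 0)"
| "boltzmann \<alpha> \<beta> \<gamma> x (Color a) S (Color b) S' =
     (if a = b then
        (if S' = S then
           (if a \<in> S then 1 + Const (\<alpha> + \<beta> + \<gamma>) * x else x) * Const ((\<alpha> * \<beta>) ^ num_gt S a)
         else 0)
      else if a \<in> S \<and> b \<notin> S \<and> S' = (S \<union> {b}) - {a} then
        (if a < b then
           Const ((-\<alpha>) ^ num_gt S b * (-\<beta>) ^ num_gt S a) * (1 + Const (\<alpha> + \<gamma>) * x)
         else
           Const ((-\<alpha>) ^ num_gt S' b * (-\<beta>) ^ num_gt S a) * (1 + Const (\<beta> + \<gamma>) * x))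
      else 0)"

text \<open>
  Edges of the grid with rows \<open>1, \<dots>, n\<close> (top to bottom) and columns \<open>N, \<dots>, 0\<close> (left to
  right): the vertex in row \<open>i\<close> and column \<open>k\<close> has west edge \<open>hor (i, k + 1)\<close>, north edge
  \<open>ver (i - 1, k)\<close>, east edge \<open>hor (i, k)\<close> and south edge \<open>ver (i, k)\<close>. Labelings
  are extensional functions on the edges, so that the set of states is finite.
\<close>

type_synonym lattice_state = "(nat \<times> nat \<Rightarrow> hlabel) \<times> (nat \<times> nat \<Rightarrow> nat set)"

definition labelings :: "nat \<Rightarrow> nat \<Rightarrow> lattice_state set" where
  "labelings n N =
     (({1..n} \<times> {0..N + 1}) \<rightarrow>\<^sub>E insert Plus (Color ` {1..n})) \<times>
     (({0..n} \<times> {0..N}) \<rightarrow>\<^sub>E Pow {1..n})"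

definition system ::
    "nat \<Rightarrow> nat \<Rightarrow> (nat \<Rightarrow> nat) \<Rightarrow> (nat \<Rightarrow> nat) \<Rightarrow> lattice_state set" where
  "system n N w mu =
     {(hor, ver) \<in> labelings n N.
        (\<forall>i\<in>{1..n}. hor (i, N + 1) = Color (n + 1 - inv w i)) \<and>
        (\<forall>i\<in>{1..n}. hor (i, 0) = Plus) \<and>
        (\<forall>k\<in>{0..N}. ver (0, k) = {i \<in> {1..n}. mu i = k}) \<and>
        (\<forall>k\<in>{0..N}. ver (n, k) = {})}"

definition state_weight ::
    "'a::field \<Rightarrow> 'a \<Rightarrow> 'a \<Rightarrow> nat \<Rightarrow> nat \<Rightarrow> lattice_state \<Rightarrow> 'a xpoly" where
  "state_weight \<alpha> \<beta> \<gamma> n N = (\<lambda>(hor, ver).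
     \<Prod>i = 1..n. \<Prod>k = 0..N.
       boltzmann \<alpha> \<beta> \<gamma> (X i) (hor (i, k + 1)) (ver (i - 1, k)) (hor (i, k)) (ver (i, k)))"

definition partition_function ::
    "'a::field \<Rightarrow> 'a \<Rightarrow> 'a \<Rightarrow> nat \<Rightarrow> nat \<Rightarrow> lattice_state set \<Rightarrow> 'a xpoly" where
  "partition_function \<alpha> \<beta> \<gamma> n N \<S> = (\<Sum>s\<in>\<S>. state_weight \<alpha> \<beta> \<gamma> n N s)"

definition rho :: "nat \<Rightarrow> nat \<Rightarrow> nat" where
  "rho n i = n - i"


section \<open>The divided difference is well defined\<close>

lemma inj_map_key_transpose:
  "inj (Poly_Mapping.map_key (transpose a b) :: (nat \<Rightarrow>\<^sub>0 nat) \<Rightarrow> _)"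
proof (rule inj_on_inverseI)
  fix p :: "nat \<Rightarrow>\<^sub>0 nat"
  show "Poly_Mapping.map_key (transpose a b) (Poly_Mapping.map_key (transpose a b) p) = p"
    by (simp add: map_key_compose inj_transpose transpose_comp_involutory id_def map_key_id)
qed

lemma lookup_swap_vars:
  "Poly_Mapping.lookup (swap_vars i f) m =
     Poly_Mapping.lookup f (Poly_Mapping.map_key (transpose i (i + 1)) m)"
  unfolding swap_vars_def
  by (simp add: map_key.rep_eq inj_map_key_transpose)

lemma swap_vars_add: "swap_vars i (f + g) = swap_vars i f + swap_vars i g"
  unfolding swap_vars_def by (rule map_key_plus[OF inj_map_key_transpose])

lemma swap_vars_single:
  "swap_vars i (Poly_Mapping.single m c) =
     Poly_Mapping.single (Poly_Mapping.map_key (transpose i (i + 1)) m) c"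
proof -
  let ?s = "Poly_Mapping.map_key (transpose i (i + 1)) :: (nat \<Rightarrow>\<^sub>0 nat) \<Rightarrow> _"
  have "?s (?s m) = m"
    by (simp add: map_key_compose inj_transpose transpose_comp_involutory id_def map_key_id)
  then show ?thesis
    unfolding swap_vars_def using map_key_single[OF inj_map_key_transpose, of i "i + 1" "?s m" c]
    by simp
qed

lemma X_power: "X i ^ a = Poly_Mapping.single (Poly_Mapping.single i a) 1"
  by (induction a) (simp_all add: X_def mult_single single_add[symmetric])

lemma X_diff_dvd_single:
  fixes c :: "'a::field"
  shows "X (i + 1) - X i dvd swap_vars i (Poly_Mapping.single m c) - Poly_Mapping.single m c"
proof -
  define a b where "a = Poly_Mapping.lookup m i" and "b = Poly_Mapping.lookup m (i + 1)"
  define r where "r = m - Poly_Mapping.single i a - Poly_Mapping.single (i + 1) b"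
  define u v R where "u = (X i :: 'a xpoly)" and "v = (X (i + 1) :: 'a xpoly)"
    and "R = Poly_Mapping.single r c"
  have m: "m = r + Poly_Mapping.single i a + Poly_Mapping.single (i + 1) b"
    by (rule poly_mapping_eqI)
       (auto simp: r_def a_def b_def lookup_add lookup_minus lookup_single when_def)
  have sm: "Poly_Mapping.map_key (transpose i (i + 1)) m =
      r + Poly_Mapping.single i b + Poly_Mapping.single (i + 1) a"
    by (rule poly_mapping_eqI)
       (auto simp: r_def a_def b_def lookup_add lookup_minus lookup_single when_def
          map_key.rep_eq inj_transpose transpose_def)
  have 1: "Poly_Mapping.single m c = R * u ^ a * v ^ b"
    unfolding R_def u_def v_def X_power by (subst m) (simp add: mult_single)
  have 2: "swap_vars i (Poly_Mapping.single m c) = R * u ^ b * v ^ a"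
    unfolding R_def u_def v_def X_power swap_vars_single sm by (simp add: mult_single)
  have d: "v - u dvd v ^ k - u ^ k" for k
    by (subst power_diff_sumr2) simp
  have "R * u ^ b * v ^ a - R * u ^ a * v ^ b =
      R * u ^ b * (v ^ a - u ^ a) - R * u ^ a * (v ^ b - u ^ b)"
    by (simp add: algebra_simps)
  also have "v - u dvd \<dots>"
    by (intro dvd_diff dvd_mult d)
  finally show ?thesis by (simp only: 2) (simp only: 1 u_def v_def)
qed

lemma X_diff_dvd: "X (i + 1) - X i dvd swap_vars i f - (f :: 'a::field xpoly)"
proof (induction f rule: update_induct)
  case const
  then show ?case by (simp add: swap_vars_def map_key_zero[OF inj_map_key_transpose])
next
  case (update f m c)
  have upd: "Poly_Mapping.update m c f = f + Poly_Mapping.single m c"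
    using update(1)
    by (intro poly_mapping_eqI)
       (auto simp: lookup_add lookup_single lookup_update in_keys_iff when_def)
  have "swap_vars i (f + Poly_Mapping.single m c) - (f + Poly_Mapping.single m c) =
      (swap_vars i f - f)
        + (swap_vars i (Poly_Mapping.single m c) - Poly_Mapping.single m c)"
    by (simp only: swap_vars_add) (simp add: algebra_simps)
  then show ?case
    unfolding upd by (simp only: dvd_add[OF update(3) X_diff_dvd_single])
qed

lemma X_diff_nonzero: "X (i + 1) - X i \<noteq> (0 :: 'a::field xpoly)"
proof
  assume "X (i + 1) - X i = (0 :: 'a xpoly)"
  then have "Poly_Mapping.lookup (X (i + 1) - X i :: 'a xpoly) (Poly_Mapping.single i 1) = 0"
    by simp
  moreover have "Poly_Mapping.single (i + 1) (1::nat) \<noteq> Poly_Mapping.single i 1"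
    by (metis lookup_single_eq lookup_single_not_eq n_not_Suc_n Suc_eq_plus1 zero_neq_one)
  ultimately show False
    by (simp add: X_def lookup_minus lookup_single)
qed

lemma divided_difference_ex1:
  "\<exists>!g. (X (i + 1) - X i) * g = swap_vars i f - (f :: 'a::field xpoly)"
  using X_diff_dvd[of i f] X_diff_nonzero[of i, where 'a = 'a]
  by (metis dvdE mult_left_cancel)

lemma divided_difference_eq:
  "(X (i + 1) - X i) * divided_difference i f = swap_vars i f - (f :: 'a::field xpoly)"
  unfolding divided_difference_def by (rule theI'[OF divided_difference_ex1])

end

theory Submission
  imports Defs
begin

text \<open>
  The partition function satisfies the recursion that defines the twisted Kirillov
  polynomials. The recursion comes from the Yang--Baxter equation, and the two sides agree
  at the identity permutation, where the model has a single state.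

  Colors are conserved at a vertex, so its west, north and east labels determine its south
  label. The vertical labels of a state can therefore be eliminated, and the
  partition function becomes an iterated sum over the horizontal labels on the cuts between
  neighbouring columns, called \<open>grid\<close> below
  (\<open>partition_function_eq_grid\<close>).

  The weights have an R-matrix, with diagonal entries \<open>rdiag\<close> and off-diagonal entries
  \<open>roff\<close>: it intertwines a column of two vertices with parameters \<open>x, y\<close> with the column in
  which the parameters are exchanged (\<open>yang_baxter\<close>). Moving the R-matrix through the
  columns from left to right leaves at the right boundary only its entry for the
  labels \<open>++\<close>, which is the factor in front of the divided difference. The result
  (\<open>grid_exchange\<close>) expresses the grid with two neighbouring parameters exchanged by the
  grids in which instead the two west labels are kept or exchanged. If the upper of these two
  labels is the larger color, then the R-matrix entries turn this relation into
  \<open>Z(s\<^sub>i w) = T\<^sub>i Z(w)\<close> (\<open>T_op_grid\<close>).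

  The upper west label is the larger one exactly when multiplication by \<open>s\<^sub>i\<close> lengthens \<open>w\<close>,
  and this is the case at each letter of a reduced word (\<open>reduced_word_ascent\<close>, a
  form of the exchange condition). So induction along any reduced word reduces the
  theorem to \<open>w = id\<close>. There the path of each color runs straight along its row up to the column in
  which it has to leave through the top boundary, and the state has the
  monomial of the theorem as its weight (\<open>grid_identity\<close>).
\<close>

declare upt_Suc [simp del]

section \<open>Vertex weights\<close>

definition above :: "'r::idom \<Rightarrow> nat set \<Rightarrow> nat \<Rightarrow> 'r" where
  "above t S c = t ^ num_gt S c"

lemma above_empty [simp]: "above t {} c = 1"
  by (simp add: above_def num_gt_def)

lemma above_insert:
  assumes "finite S" "d \<notin> S"
  shows "above t (insert d S) c = (if c < d then t else 1) * above t S c"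
proof -
  have "{s \<in> insert d S. s \<ge> c + 1} =
      (if c < d then insert d {s \<in> S. s \<ge> c + 1} else {s \<in> S. s \<ge> c + 1})"
    by auto
  then show ?thesis
    using assms by (simp add: above_def num_gt_def)
qed

fun colors_of :: "hlabel \<Rightarrow> nat set" where
  "colors_of Plus = {}"
| "colors_of (Color c) = {c}"

text \<open>
  The south label that color conservation forces on a vertex with nonzero weight.
\<close>

fun south :: "hlabel \<Rightarrow> nat set \<Rightarrow> hlabel \<Rightarrow> nat set" where
  "south Plus S Plus = S"
| "south Plus S (Color d) = insert d S"
| "south (Color c) S Plus = S - {c}"
| "south (Color c) S (Color d) = (if c = d then S else insert d (S - {c}))"

lemma finite_south [simp]: "finite S \<Longrightarrow> finite (south p S q)"
  by (cases p; cases q) auto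

lemma mem_south:
  "c \<in> south p S q \<longleftrightarrow>
     (if p = q then c \<in> S else q = Color c \<or> (c \<in> S \<and> p \<noteq> Color c))"
  by (cases p; cases q) auto

text \<open>
  The weights of \<open>(+, \<Sigma>, +, \<Sigma>)\<close> and \<open>(c, \<Sigma>, +, \<Sigma> \<setminus> {c})\<close> depend on \<open>\<Sigma>\<close> through its size and
  complete homogeneous polynomials. Both are expressed by one sequence: \<open>v k\<close> is the weight of
  \<open>(+, \<Sigma>, +, \<Sigma>)\<close> at spectral parameter \<open>0\<close> when \<open>\<Sigma>\<close> has \<open>k\<close> elements. Its linear
  recurrence carries the Yang--Baxter equation; its initial values give a vertex with all
  labels empty the weight \<open>1\<close>.
\<close>

locale lattice_weights =
  fixes a b g :: "'r::idom" and v :: "nat \<Rightarrow> 'r"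
  assumes v_0: "v 0 = 1" and v_1: "v (Suc 0) = g"
    and v_rec: "\<And>n. v (Suc (Suc n)) = - (a + b) * v (Suc n) - a * b * v n"
begin

definition fa :: "'r \<Rightarrow> 'r" where "fa x = 1 + (a + g) * x"
definition fb :: "'r \<Rightarrow> 'r" where "fb x = 1 + (b + g) * x"

text \<open>
  The south label is left out, as it has to be \<open>south p S q\<close>. In the last case the
  power of \<open>-a\<close> counts colors in \<open>S - {c}\<close>. This is the uniform description of the two
  vertices in which one color replaces another: the color \<open>c\<close> leaves before \<open>d\<close> is inserted.
\<close>

fun wt :: "'r \<Rightarrow> hlabel \<Rightarrow> nat set \<Rightarrow> hlabel \<Rightarrow> 'r" where
  "wt x Plus S Plus = (1 + g * x) * v (card S) - x * v (Suc (card S))"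
| "wt x Plus S (Color d) = (if d \<in> S then 0 else above (- a) S d * (fa x * fb x))"
| "wt x (Color c) S Plus = (if c \<in> S then above (- b) S c * v (card S - 1) else 0)"
| "wt x (Color c) S (Color d) =
     (if c = d
      then (if c \<in> S then 1 + (a + b + g) * x else x) * (above (- a) S c * above (- b) S c)
      else if c \<in> S \<and> d \<notin> S
      then above (- a) (S - {c}) d * above (- b) S c * (if c < d then fa x else fb x)
      else 0)"

lemma wt_absent_west: "c \<notin> S \<Longrightarrow> q \<noteq> Color c \<Longrightarrow> wt x (Color c) S q = 0"
  by (cases q) auto

lemma wt_present_east: "c \<in> S \<Longrightarrow> p \<noteq> Color c \<Longrightarrow> wt x p S (Color c) = 0"
  by (cases p) auto


section \<open>The Yang--Baxter equation\<close>

text \<open>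
  The R-matrix sends a pair of labels to itself with coefficient \<open>rdiag\<close> and to the exchanged pair
  with coefficient \<open>roff\<close>. In \<open>roff\<close> the label \<open>+\<close> acts as a color below all others. The common
  factor of the entries is chosen such that the entry \<open>rnorm\<close> for \<open>++\<close> is the polynomial in
  front of the divided difference.
\<close>

definition rnorm :: "'r \<Rightarrow> 'r \<Rightarrow> 'r" where
  "rnorm x y = 1 + (a + b + g) * x + g * y + (b + g) * (a + g) * x * y"

fun rdiag :: "'r \<Rightarrow> 'r \<Rightarrow> hlabel \<Rightarrow> hlabel \<Rightarrow> 'r" where
  "rdiag x y Plus Plus = rnorm x y"
| "rdiag x y Plus (Color c) = fa y * fb y"
| "rdiag x y (Color c) Plus = fa x * fb x"
| "rdiag x y (Color c) (Color d) =
     (if c = d then rnorm y x else if d < c then fa x * fb y else fa y * fb x)"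

fun roff :: "'r \<Rightarrow> 'r \<Rightarrow> hlabel \<Rightarrow> hlabel \<Rightarrow> 'r" where
  "roff x y Plus Plus = 0"
| "roff x y Plus (Color c) = a * b * (y - x)"
| "roff x y (Color c) Plus = y - x"
| "roff x y (Color c) (Color d) =
     (if c = d then 0 else if d < c then y - x else a * b * (y - x))"

text \<open>
  Two vertices on top of each other. The function \<open>f\<close> of the bottom label stands for
  whatever is attached below, so that an identity for all \<open>f\<close> compares bottom
  labels as well as weights.
\<close>

definition pair_wt ::
    "'r \<Rightarrow> 'r \<Rightarrow> hlabel \<Rightarrow> hlabel \<Rightarrow> nat set \<Rightarrow> hlabel \<Rightarrow> hlabel \<Rightarrow> (nat set \<Rightarrow> 'r) \<Rightarrow> 'r"
  where
  "pair_wt x y p1 p2 S q1 q2 f =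
     wt x p1 S q1 * wt y p2 (south p1 S q1) q2 * f (south p2 (south p1 S q1) q2)"

definition yang_baxter ::
    "'r \<Rightarrow> 'r \<Rightarrow> hlabel \<Rightarrow> hlabel \<Rightarrow> nat set \<Rightarrow> hlabel \<Rightarrow> hlabel \<Rightarrow> (nat set \<Rightarrow> 'r) \<Rightarrow> bool"
  where
  "yang_baxter x y p1 p2 S q1 q2 f \<longleftrightarrow>
     pair_wt y x p1 p2 S q1 q2 f * rdiag x y q1 q2 +
     pair_wt y x p1 p2 S q2 q1 f * roff x y q2 q1 =
     rdiag x y p1 p2 * pair_wt x y p1 p2 S q1 q2 f +
     roff x y p1 p2 * pair_wt x y p2 p1 S q1 q2 f"

text \<open>
  If a color enters from the west and does not leave to the east, it has to leave through the
  top edge, and it can do so only once.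
\<close>

lemma pair_wt_unbalanced_west:
  assumes "Color c \<in> {p1, p2}" "Color c \<notin> {q1, q2}" "c \<notin> S \<or> p1 = p2"
  shows "pair_wt x y p1 p2 S q1 q2 f = 0"
  using assms wt_absent_west[of c S q1 x] wt_absent_west[of c "south p1 S q1" q2 y]
    mem_south[of c p1 S q1]
  by (auto simp: pair_wt_def split: if_splits)

text \<open>
  Dually, a color that leaves to the east without entering from the west comes from the
  bottom edge, where it can enter only once; it is then absent from the top edge.
\<close>

lemma pair_wt_unbalanced_east:
  assumes "Color c \<in> {q1, q2}" "Color c \<notin> {p1, p2}" "c \<in> S \<or> q1 = q2"
  shows "pair_wt x y p1 p2 S q1 q2 f = 0"
  using assms wt_present_east[of c S p1 x] wt_present_east[of c "south p1 S q1" p2 y]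
    mem_south[of c p1 S q1]
  by (auto simp: pair_wt_def split: if_splits)

lemma yang_baxter_trivial:
  assumes "\<And>x y. pair_wt x y p1 p2 S q1 q2 f = 0" "\<And>x y. pair_wt x y p1 p2 S q2 q1 f = 0"
    "\<And>x y. pair_wt x y p2 p1 S q1 q2 f = 0"
  shows "yang_baxter x y p1 p2 S q1 q2 f"
  by (simp only: yang_baxter_def assms mult_zero_left mult_zero_right)

lemma yang_baxter_unbalanced_west:
  assumes "Color c \<in> {p1, p2}" "Color c \<notin> {q1, q2}" "c \<notin> S \<or> p1 = p2"
  shows "yang_baxter x y p1 p2 S q1 q2 f"
  by (rule yang_baxter_trivial; rule pair_wt_unbalanced_west[of c]) (use assms in auto)

lemma yang_baxter_unbalanced_east:
  assumes "Color c \<in> {q1, q2}" "Color c \<notin> {p1, p2}" "c \<in> S \<or> q1 = q2"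
  shows "yang_baxter x y p1 p2 S q1 q2 f"
  by (rule yang_baxter_trivial; rule pair_wt_unbalanced_east[of c]) (use assms in auto)

lemma order_cases:
  assumes "(c::nat) \<noteq> d" "c < d \<Longrightarrow> \<not> d < c \<Longrightarrow> P" "d < c \<Longrightarrow> \<not> c < d \<Longrightarrow> P"
  shows P
  using assms by linarith

lemma Diff_absent: "c \<notin> S \<Longrightarrow> S - {c} = S"
  by blast

text \<open>
  Once the relative order of the colors and their membership in the top label are known, these
  rules evaluate both sides of the equation to polynomials. The powers that count the other
  colors of the top label remain as opaque factors common to all terms, and \<open>v_rec\<close> leaves only
  two consecutive values of \<open>v\<close>.
\<close>

lemmas yang_baxter_eval =
  yang_baxter_def pair_wt_def wt.simps south.simps rdiag.simps roff.simps rnorm_def fa_def fb_def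
  above_insert v_rec card.insert diff_Suc_1 finite_insert insert_Diff_if Diff_absent insert_commute
  insert_iff empty_iff Un_insert_left Un_empty_left
  less_imp_not_eq less_imp_not_eq2 less_irrefl simp_thms if_True if_False
  mult_zero_left mult_zero_right mult_1_left add_0_left add_0_right

text \<open>
  The four labels name no color twice. Then the top label contains the colors
  entering from the west, and none of those leaving to the east. In this lemma and
  the next three, \<open>order_cases\<close> runs through the relative orders of the colors, \<open>linarith\<close>
  discards those that are not transitive, and a polynomial identity is left for each of the others.
\<close>

lemma yang_baxter_distinct:
  assumes "finite S" "colors_of p1 \<inter> colors_of p2 = {}" "colors_of q1 \<inter> colors_of q2 = {}"
    "(colors_of p1 \<union> colors_of p2) \<inter> (colors_of q1 \<union> colors_of q2) = {}"
    "(colors_of p1 \<union> colors_of p2 \<union> colors_of q1 \<union> colors_of q2) \<inter> S = {}"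
  shows "yang_baxter x y p1 p2 (colors_of p1 \<union> colors_of p2 \<union> S) q1 q2 f"
  using assms
  by (cases p1; cases p2; cases q1; cases q2; clarsimp)
    (linarith | erule order_cases |
      (simp only: yang_baxter_eval; ((thin_tac "PROP _")+)?; algebra?))+

text \<open>
  One color enters from the west and leaves to the east. It may also be present on the top edge, as a
  path of this color may pass through vertically.
\<close>

lemma yang_baxter_shared:
  assumes "finite S" "c \<notin> S" "c \<notin> colors_of p \<union> colors_of q" "colors_of p \<inter> colors_of q = {}"
    "(colors_of p \<union> colors_of q) \<inter> S = {}" "T = S \<or> T = insert c S"
  shows "yang_baxter x y (Color c) p (colors_of p \<union> T) (Color c) q f"
    "yang_baxter x y (Color c) p (colors_of p \<union> T) q (Color c) f"
    "yang_baxter x y p (Color c) (colors_of p \<union> T) (Color c) q f"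
    "yang_baxter x y p (Color c) (colors_of p \<union> T) q (Color c) f"
  using assms
  by - (cases p; cases q; erule disjE; clarsimp;
    (linarith | erule order_cases |
      (simp only: yang_baxter_eval; ((thin_tac "PROP _")+)?; algebra?))+)+

lemma yang_baxter_shared_pair:
  assumes "finite S" "c \<notin> S" "d \<notin> S" "c \<noteq> d"
    "T = S \<or> T = insert c S \<or> T = insert d S \<or> T = insert c (insert d S)"
  shows "yang_baxter x y (Color c) (Color d) T (Color c) (Color d) f"
    "yang_baxter x y (Color c) (Color d) T (Color d) (Color c) f"
  using assms
  by - (elim disjE; clarsimp;
    (linarith | erule order_cases |
      (simp only: yang_baxter_eval; ((thin_tac "PROP _")+)?; algebra?))+)+

text \<open>
  Here \<open>c\<close> occupies both west edges or both east edges. A state of the whole model contains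
  each color once only, but admitting these labels keeps the equation free of
  side conditions.
\<close>

lemma yang_baxter_double:
  assumes "finite S" "c \<notin> S" "c \<notin> colors_of p" "colors_of p \<inter> S = {}"
    "T = S \<or> T = insert c S"
  shows "yang_baxter x y (Color c) (Color c) T (Color c) p f"
    "yang_baxter x y (Color c) (Color c) T p (Color c) f"
    "yang_baxter x y (Color c) p (colors_of p \<union> T) (Color c) (Color c) f"
    "yang_baxter x y p (Color c) (colors_of p \<union> T) (Color c) (Color c) f"
    "yang_baxter x y (Color c) (Color c) T (Color c) (Color c) f"
  using assms
  by - (cases p; erule disjE; clarsimp;
    (linarith | erule order_cases |
      (simp only: yang_baxter_eval; ((thin_tac "PROP _")+)?; algebra?))+)+

end

context lattice_weights
begin

text \<open>
  By color conservation all terms vanish unless the colors on the west side only leave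
  through the top and those on the east side only come from the bottom; the remaining label patterns are those of the preceding four lemmas.
\<close>

theorem yang_baxter:
  assumes fin: "finite S"
  shows "yang_baxter x y p1 p2 S q1 q2 f"
proof -
  consider
      (west) c where "Color c \<in> {p1, p2}" "Color c \<notin> {q1, q2}" "c \<notin> S \<or> p1 = p2"
    | (east) c where "Color c \<in> {q1, q2}" "Color c \<notin> {p1, p2}" "c \<in> S \<or> q1 = q2"
    | (balanced)
        "\<And>c. Color c \<in> {p1, p2} \<Longrightarrow> Color c \<notin> {q1, q2} \<Longrightarrow> c \<in> S \<and> p1 \<noteq> p2"
        "\<And>c. Color c \<in> {q1, q2} \<Longrightarrow> Color c \<notin> {p1, p2} \<Longrightarrow> c \<notin> S \<and> q1 \<noteq> q2"
    by blast
  then show ?thesis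
  proof cases
    case west
    then show ?thesis by (rule yang_baxter_unbalanced_west)
  next
    case east
    then show ?thesis by (rule yang_baxter_unbalanced_east)
  next
    case balanced
    show ?thesis
    proof (cases "\<exists>c. Color c \<in> {p1, p2} \<and> Color c \<in> {q1, q2}")
      case False
      define S0 where "S0 = S - (colors_of p1 \<union> colors_of p2)"
      have S: "S = colors_of p1 \<union> colors_of p2 \<union> S0"
        using False balanced(1) by (cases p1; cases p2) (auto simp: S0_def)
      have "colors_of p1 \<inter> colors_of p2 = {}"
        using False balanced(1) by (cases p1; cases p2) auto
      moreover have "colors_of q1 \<inter> colors_of q2 = {}"
        using False balanced(2) by (cases q1; cases q2) auto
      moreover have "(colors_of p1 \<union> colors_of p2) \<inter> (colors_of q1 \<union> colors_of q2) = {}"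
        using False by (cases p1; cases p2; cases q1; cases q2) auto
      moreover have "(colors_of p1 \<union> colors_of p2 \<union> colors_of q1 \<union> colors_of q2) \<inter> S0 = {}"
        using False balanced(2) by (cases q1; cases q2) (auto simp: S0_def)
      ultimately show ?thesis
        using fin by (subst S) (rule yang_baxter_distinct; simp add: S0_def)
    next
      case True
      then obtain c p q where p: "p1 = Color c \<and> p2 = p \<or> p1 = p \<and> p2 = Color c"
        and q: "q1 = Color c \<and> q2 = q \<or> q1 = q \<and> q2 = Color c"
        by blast
      define S0 where "S0 = S - {c} - colors_of p"
      have S0: "finite S0" "c \<notin> S0" "colors_of p \<inter> S0 = {}"
        using fin by (auto simp: S0_def)
      consider "p = Color c" "q = Color c" | "p = Color c" "q \<noteq> Color c"
        | "p \<noteq> Color c" "q = Color c" | d where "p = Color d" "q = Color d" "d \<noteq> c"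
        | "p \<noteq> Color c" "q \<noteq> Color c" "colors_of p \<inter> colors_of q = {}"
        by (cases p; cases q) auto
      then show ?thesis
      proof cases
        case 1
        then have "S = S0 \<or> S = insert c S0" by (auto simp: S0_def)
        then have "yang_baxter x y (Color c) (Color c) S (Color c) (Color c) f"
          by (rule yang_baxter_double(5)[OF S0(1,2), of Plus, simplified])
        then show ?thesis using p q 1 by blast
      next
        case 2
        have c: "c \<notin> colors_of q" using 2 by (cases q) auto
        have q': "colors_of q \<inter> S0 = {}"
          using p q balanced(2) 2 by (cases q) (auto simp: S0_def)
        have T: "S = S0 \<or> S = insert c S0" using 2 by (auto simp: S0_def)
        note double = yang_baxter_double(1,2)[OF S0(1,2) c q' T, of x y f]
        show ?thesis using p q 2 double by blast
      next
        case 3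
        have c: "c \<notin> colors_of p" using 3 by (cases p) auto
        have "S = colors_of p \<union> S0 \<or> S = colors_of p \<union> insert c S0"
          using p q balanced(1) 3 by (cases p) (auto simp: S0_def)
        then obtain T where S: "S = colors_of p \<union> T" and T: "T = S0 \<or> T = insert c S0"
          by blast
        note double = yang_baxter_double(3,4)[OF S0(1,2) c S0(3) T, of x y f]
        show ?thesis using p q 3 double unfolding S by blast
      next
        case (4 d)
        then have S: "S = S0 \<or> S = insert c S0 \<or> S = insert d S0 \<or> S = insert c (insert d S0)"
          by (auto simp: S0_def)
        then have S': "S = S0 \<or> S = insert d S0 \<or> S = insert c S0 \<or> S = insert d (insert c S0)"
          by (auto simp: insert_commute)
        have "d \<notin> S0" using 4 S0 by auto
        then have "yang_baxter x y (Color c) (Color d) S (Color c) (Color d) f"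
          "yang_baxter x y (Color c) (Color d) S (Color d) (Color c) f"
          "yang_baxter x y (Color d) (Color c) S (Color d) (Color c) f"
          "yang_baxter x y (Color d) (Color c) S (Color c) (Color d) f"
          using yang_baxter_shared_pair[OF S0(1,2) _ _ S] yang_baxter_shared_pair[OF S0(1) _ S0(2) _ S'] 4(3)
          by blast+
        then show ?thesis using p q 4 by blast
      next
        case 5
        then have c: "c \<notin> colors_of p \<union> colors_of q" by (cases p; cases q) auto
        have pq: "(colors_of p \<union> colors_of q) \<inter> S0 = {}"
          using p q balanced(2) 5 by (cases p; cases q) (auto simp: S0_def)
        have "S = colors_of p \<union> S0 \<or> S = colors_of p \<union> insert c S0"
          using p q balanced(1) 5 by (cases p; cases q) (auto simp: S0_def)
        then obtain T where S: "S = colors_of p \<union> T" and T: "T = S0 \<or> T = insert c S0"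
          by blast
        note shared = yang_baxter_shared[OF S0(1,2) c 5(3) pq T, of x y f]
        show ?thesis using p q shared unfolding S by blast
      qed
    qed
  qed
qed


section \<open>Columns and grids\<close>

text \<open>
  One column with spectral parameters \<open>xs\<close>, west labels \<open>ps\<close>, top label \<open>S\<close> and east
  labels \<open>qs\<close>, listed from top to bottom. The vertical labels inside are determined,
  and the bottom one has to be empty.
\<close>

fun column :: "'r list \<Rightarrow> hlabel list \<Rightarrow> nat set \<Rightarrow> hlabel list \<Rightarrow> 'r" where
  "column (x # xs) (p # ps) S (q # qs) = wt x p S q * column xs ps (south p S q) qs"
| "column [] [] S [] = of_bool (S = {})"
| "column _ _ _ _ = 0"

text \<open>
  The columns with top labels \<open>Ss\<close>, from left to right, with west boundary \<open>ps\<close> and east boundary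
  \<open>+\<close>; the labels on each inner cut run over \<open>L\<close>.
\<close>

fun grid :: "hlabel set \<Rightarrow> 'r list \<Rightarrow> hlabel list \<Rightarrow> nat set list \<Rightarrow> 'r" where
  "grid L xs ps [] = of_bool (set ps \<subseteq> {Plus})"
| "grid L xs ps (S # Ss) =
     (\<Sum>qs | set qs \<subseteq> L \<and> length qs = length ps. column xs ps S qs * grid L xs qs Ss)"

end

fun swap_at :: "nat \<Rightarrow> 'x list \<Rightarrow> 'x list" where
  "swap_at 0 (x # y # xs) = y # x # xs"
| "swap_at (Suc i) (x # xs) = x # swap_at i xs"
| "swap_at _ xs = xs"

lemma swap_at_swap_at [simp]: "swap_at i (swap_at i xs) = xs"
  by (induction i xs rule: swap_at.induct) auto

lemma length_swap_at [simp]: "length (swap_at i xs) = length xs"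
  by (induction i xs rule: swap_at.induct) auto

lemma set_swap_at [simp]: "set (swap_at i xs) = set xs"
  by (induction i xs rule: swap_at.induct) auto

lemma nth_swap_at:
  "Suc i < length xs \<Longrightarrow> k < length xs \<Longrightarrow> swap_at i xs ! k = xs ! transpose i (Suc i) k"
proof (induction i xs arbitrary: k rule: swap_at.induct)
  case (1 x y xs)
  then show ?case by (cases k; cases "k - 1") (auto simp: transpose_def)
next
  case (2 i x xs)
  then show ?case by (cases k) (auto simp: transpose_def)
qed auto

context lattice_weights
begin

text \<open>
  The vertices above the two exchanged rows contribute a factor common to all terms; those below are the
  function \<open>f\<close> of the Yang--Baxter equation.
\<close>

lemma column_exchange:
  assumes "finite S" "Suc i < length xs" "length ps = length xs" "length qs = length xs"
  shows "column (swap_at i xs) ps S qs * rdiag (xs ! i) (xs ! Suc i) (qs ! i) (qs ! Suc i)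
      + column (swap_at i xs) ps S (swap_at i qs) * roff (xs ! i) (xs ! Suc i) (qs ! Suc i) (qs ! i)
    = rdiag (xs ! i) (xs ! Suc i) (ps ! i) (ps ! Suc i) * column xs ps S qs
      + roff (xs ! i) (xs ! Suc i) (ps ! i) (ps ! Suc i) * column xs (swap_at i ps) S qs"
  using assms
proof (induction i arbitrary: xs ps S qs)
  case 0
  obtain x y xs' where xs: "xs = x # y # xs'"
    using 0 by (cases xs; cases "tl xs") auto
  obtain p1 p2 ps' where ps: "ps = p1 # p2 # ps'"
    using 0 by (cases ps; cases "tl ps") auto
  obtain q1 q2 qs' where qs: "qs = q1 # q2 # qs'"
    using 0 by (cases qs; cases "tl qs") auto
  show ?case
    using yang_baxter[OF 0(1), of x y p1 p2 q1 q2 "\<lambda>T. column xs' ps' T qs'"]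
    by (simp add: xs ps qs yang_baxter_def pair_wt_def mult.assoc)
next
  case (Suc i)
  obtain x xs' where xs: "xs = x # xs'" using Suc.prems by (cases xs) auto
  obtain p ps' where ps: "ps = p # ps'" using Suc.prems by (cases ps) auto
  obtain q qs' where qs: "qs = q # qs'" using Suc.prems by (cases qs) auto
  have "column (swap_at i xs') ps' (south p S q) qs' * rdiag (xs' ! i) (xs' ! Suc i) (qs' ! i) (qs' ! Suc i)
      + column (swap_at i xs') ps' (south p S q) (swap_at i qs') * roff (xs' ! i) (xs' ! Suc i) (qs' ! Suc i) (qs' ! i)
    = rdiag (xs' ! i) (xs' ! Suc i) (ps' ! i) (ps' ! Suc i) * column xs' ps' (south p S q) qs'
      + roff (xs' ! i) (xs' ! Suc i) (ps' ! i) (ps' ! Suc i) * column xs' (swap_at i ps') (south p S q) qs'"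
    using Suc.prems by (intro Suc.IH) (auto simp: xs ps qs)
  from arg_cong[OF this, of "\<lambda>z. wt x p S q * z"] show ?case
    by (simp add: xs ps qs algebra_simps)
qed

text \<open>
  The R-matrix moves through one column after another. Behind the last column both labels are
  \<open>+\<close>, and its entry there is \<open>rnorm\<close>.
\<close>

theorem grid_exchange:
  assumes "finite L" "\<forall>S\<in>set Ss. finite S" "Suc i < length xs" "length ps = length xs"
  shows "rnorm (xs ! i) (xs ! Suc i) * grid L (swap_at i xs) ps Ss =
      rdiag (xs ! i) (xs ! Suc i) (ps ! i) (ps ! Suc i) * grid L xs ps Ss
      + roff (xs ! i) (xs ! Suc i) (ps ! i) (ps ! Suc i) * grid L xs (swap_at i ps) Ss"
  using assms
proof (induction Ss arbitrary: ps)
  case Nil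
  show ?case
  proof (cases "set ps \<subseteq> {Plus}")
    case True
    then have "ps ! i = Plus" "ps ! Suc i = Plus"
      using Nil by (metis Suc_lessD nth_mem singletonD subset_iff)+
    then show ?thesis using True by simp
  qed simp
next
  case (Cons S Ss)
  let ?x = "xs ! i" and ?y = "xs ! Suc i"
  let ?A = "{qs. set qs \<subseteq> L \<and> length qs = length xs}"
  have swap: "(\<Sum>qs\<in>?A. h (swap_at i qs)) = (\<Sum>qs\<in>?A. h qs)" for h :: "hlabel list \<Rightarrow> 'r"
    by (rule sum.reindex_bij_witness[of _ "swap_at i" "swap_at i"]) auto
  have "rnorm ?x ?y * grid L (swap_at i xs) ps (S # Ss) =
      (\<Sum>qs\<in>?A. column (swap_at i xs) ps S qs * (rnorm ?x ?y * grid L (swap_at i xs) qs Ss))"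
    using Cons.prems by (simp add: sum_distrib_left mult_ac)
  also have "\<dots> = (\<Sum>qs\<in>?A. column (swap_at i xs) ps S qs *
      (rdiag ?x ?y (qs ! i) (qs ! Suc i) * grid L xs qs Ss
        + roff ?x ?y (qs ! i) (qs ! Suc i) * grid L xs (swap_at i qs) Ss))"
    using Cons.prems by (intro sum.cong refl) (simp add: Cons.IH)
  also have "\<dots> = (\<Sum>qs\<in>?A. column (swap_at i xs) ps S qs *
        rdiag ?x ?y (qs ! i) (qs ! Suc i) * grid L xs qs Ss)
      + (\<Sum>qs\<in>?A. column (swap_at i xs) ps S qs *
        roff ?x ?y (qs ! i) (qs ! Suc i) * grid L xs (swap_at i qs) Ss)"
    by (simp add: sum.distrib algebra_simps)
  \<comment> \<open>Exchanging the two labels on the cut makes the same grid appear in both sums, so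
    that \<open>column_exchange\<close> applies under the summation sign.\<close>
  also have "(\<Sum>qs\<in>?A. column (swap_at i xs) ps S qs *
        roff ?x ?y (qs ! i) (qs ! Suc i) * grid L xs (swap_at i qs) Ss) =
      (\<Sum>qs\<in>?A. column (swap_at i xs) ps S (swap_at i qs) *
        roff ?x ?y (qs ! Suc i) (qs ! i) * grid L xs qs Ss)"
    using Cons.prems
    by (subst swap[symmetric]) (intro sum.cong refl, auto simp: nth_swap_at)
  also have "(\<Sum>qs\<in>?A. column (swap_at i xs) ps S qs *
        rdiag ?x ?y (qs ! i) (qs ! Suc i) * grid L xs qs Ss) + \<dots> =
      (\<Sum>qs\<in>?A. (rdiag ?x ?y (ps ! i) (ps ! Suc i) * column xs ps S qs
        + roff ?x ?y (ps ! i) (ps ! Suc i) * column xs (swap_at i ps) S qs) * grid L xs qs Ss)"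
    unfolding sum.distrib[symmetric]
    using Cons.prems
    by (intro sum.cong refl, subst column_exchange[symmetric]) (auto simp: distrib_right)
  also have "\<dots> = rdiag ?x ?y (ps ! i) (ps ! Suc i) * grid L xs ps (S # Ss)
      + roff ?x ?y (ps ! i) (ps ! Suc i) * grid L xs (swap_at i ps) (S # Ss)"
    using Cons.prems by (simp add: sum_distrib_left sum.distrib algebra_simps)
  finally show ?case .
qed

text \<open>
  Used for the homomorphism that exchanges two variables: it acts on the spectral
  parameters alone.
\<close>

lemma grid_hom:
  assumes add: "\<And>x y. h (x + y) = h x + h y" and mult: "\<And>x y. h (x * y) = h x * h y"
    and h1: "h 1 = 1" and fixed: "h a = a" "h b = b" "h g = g" "\<And>k. h (v k) = v k"
  shows "h (grid L xs ps Ss) = grid L (map h xs) ps Ss"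
proof -
  have "h 0 + h 0 = h 0 + 0" using add[of 0 0] by (simp only: add_0_right)
  then have h0: "h 0 = 0" by (simp only: add_left_cancel)
  have neg: "h (- x) = - h x" for x using add[of x "- x"] h0 by (simp add: eq_neg_iff_add_eq_0 add.commute)
  have diff: "h (x - y) = h x - h y" for x y using add[of x "- y"] neg by simp
  have power: "h (x ^ k) = h x ^ k" for x k by (induction k) (simp_all add: h1 mult)
  have sum: "h (sum f A) = (\<Sum>x\<in>A. h (f x))" for f :: "hlabel list \<Rightarrow> 'r" and A
    by (induction A rule: infinite_finite_induct) (simp_all add: h0 add)
  note hom = add mult h1 h0 neg diff power fixed
  have wt: "h (wt x p S q) = wt (h x) p S q" for x p S q
    by (cases p; cases q) (simp_all add: hom fa_def fb_def above_def)
  have column: "h (column xs ps S qs) = column (map h xs) ps S qs" for xs ps S qs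
    by (induction xs ps S qs rule: column.induct) (simp_all add: hom wt)
  show ?thesis
    by (induction Ss arbitrary: ps) (simp_all add: hom sum column)
qed

end

section \<open>The identity permutation\<close>

definition labels :: "nat \<Rightarrow> hlabel set" where
  "labels n = insert Plus (Color ` {1..n})"

lemma finite_labels [simp]: "finite (labels n)"
  by (simp add: labels_def)

text \<open>
  The colors that are still on the cut when \<open>1, \<dots>, k - 1\<close> have left.
\<close>

definition descending :: "nat \<Rightarrow> nat \<Rightarrow> nat list" where
  "descending n k = rev [k..<Suc n]"

lemma length_descending [simp]: "length (descending n k) = Suc n - k"
  by (simp add: descending_def)

lemma set_descending [simp]: "set (descending n k) = {k..n}"
  by (auto simp: descending_def)

lemma descending_Suc: "k \<le> n \<Longrightarrow> descending n k = descending n (Suc k) @ [k]"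
  by (simp add: descending_def upt_conv_Cons)

context lattice_weights
begin

text \<open>
  With \<open>+\<close> on all west edges no vertex removes a color from the vertical label, so this
  label stays nonempty down to the bottom.
\<close>

lemma column_Plus_nonempty:
  "S \<noteq> {} \<Longrightarrow> column xs (replicate r Plus) S qs = 0"
proof (induction r arbitrary: xs S qs)
  case 0
  then show ?case by (cases xs; cases qs) auto
next
  case (Suc r)
  have "south Plus S q \<noteq> {}" for q
    using Suc.prems by (cases q) auto
  then show ?case
    using Suc.IH by (cases xs; cases qs) auto
qed

text \<open>
  No color can leave through the top, so each crosses the column with weight \<open>x\<close>.
\<close>

lemma column_empty_top:
  assumes "length xs = length cs + r" "length qs = length xs"
  shows "column xs (map Color cs @ replicate r Plus) {} qs =
    (if qs = map Color cs @ replicate r Plus then prod_list (take (length cs) xs) else 0)"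
  using assms
proof (induction cs arbitrary: xs qs)
  case Nil
  then show ?case
  proof (induction r arbitrary: xs qs)
    case (Suc r)
    then obtain x xs' q qs' where "xs = x # xs'" "qs = q # qs'"
      by (cases xs; cases qs) auto
    then show ?case
      using Suc by (cases q) (auto simp: column_Plus_nonempty v_0 v_1)
  qed auto
next
  case (Cons c cs)
  then obtain x xs' q qs' where "xs = x # xs'" "qs = q # qs'"
    by (cases xs; cases qs) auto
  then show ?case
    using Cons by (cases q) auto
qed

text \<open>
  The colors larger than \<open>k\<close> cross the column with weight \<open>x\<close>; \<open>k\<close> enters in the row below
  them, turns up at once and leaves through the top.
\<close>

lemma column_singleton_top:
  assumes "\<forall>c\<in>set cs. k < c" "length xs = length cs + Suc r" "length qs = length xs"
  shows "column xs (map Color cs @ Color k # replicate r Plus) {k} qs =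
    (if qs = map Color cs @ replicate (Suc r) Plus then prod_list (take (length cs) xs) else 0)"
  using assms
proof (induction cs arbitrary: xs qs)
  case Nil
  then obtain x xs' q qs' where "xs = x # xs'" "qs = q # qs'"
    by (cases xs; cases qs) auto
  then show ?case
    using Nil column_empty_top[of xs' "[]" r qs']
    by (cases q) (auto simp: column_Plus_nonempty v_0 above_insert)
next
  case (Cons c cs)
  then obtain x xs' q qs' where "xs = x # xs'" "qs = q # qs'"
    by (cases xs; cases qs) auto
  then show ?case
    using Cons by (cases q) (auto simp: above_insert)
qed

lemma prod_list_take_eq_prod:
  fixes xs :: "'r list"
  assumes "length xs = n" "1 \<le> k"
  shows "prod_list (take (Suc n - k) xs) = (\<Prod>c = k..n. xs ! (n - c))"
proof -
  have "prod_list (take (Suc n - k) xs) = (\<Prod>i\<in>{0..<Suc n - k}. xs ! i)"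
    using assms by (subst prod.list_conv_set_nth) (auto intro!: prod.cong)
  also have "\<dots> = (\<Prod>c = k..n. xs ! (n - c))"
    by (rule prod.reindex_bij_witness[of _ "\<lambda>c. n - c" "\<lambda>i. n - i"]) auto
  finally show ?thesis .
qed

lemma sum_grid_eq_single:
  assumes "finite L" "st \<in> {qs. set qs \<subseteq> L \<and> length qs = n}" "length ps = n"
    and "\<And>qs. length qs = n \<Longrightarrow> column xs ps S qs = (if qs = st then P else 0)"
  shows "grid L xs ps (S # Ss) = P * grid L xs st Ss"
proof -
  have "grid L xs ps (S # Ss) =
      (\<Sum>qs | set qs \<subseteq> L \<and> length qs = n. if qs = st then P * grid L xs st Ss else 0)"
    using assms(3,4) by (auto intro!: sum.cong)
  also have "\<dots> = P * grid L xs st Ss"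
    using assms(1,2) by (subst sum.delta) (auto intro: finite_lists_length_eq)
  finally show ?thesis .
qed

text \<open>
  Here \<open>m\<close> columns are left, and \<open>k\<close> is the smallest color that has not
  left through the top. The strictly decreasing sequence \<open>mu\<close> makes the colors leave in
  increasing order, one at a time. Color \<open>c\<close> lives in the row of index \<open>n - c\<close> and crosses the
  \<open>m - 1 - mu c\<close> columns to the left of its own.
\<close>

lemma grid_identity:
  assumes "length xs = n"
    and mono: "\<And>c d. 1 \<le> c \<Longrightarrow> c < d \<Longrightarrow> d \<le> n \<Longrightarrow> mu d < mu c"
    and "1 \<le> k" "k \<le> Suc n"
    and "\<And>c. k \<le> c \<Longrightarrow> c \<le> n \<Longrightarrow> mu c < m" "\<And>c. 1 \<le> c \<Longrightarrow> c < k \<Longrightarrow> m \<le> mu c"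
  shows "grid (labels n) xs (map Color (descending n k) @ replicate (k - 1) Plus)
      (map (\<lambda>j. {i \<in> {1..n}. mu i = j}) (rev [0..<m])) =
    (\<Prod>c = k..n. xs ! (n - c) ^ (m - 1 - mu c))"
  using assms(3-)
proof (induction m arbitrary: k)
  case 0
  then have "k = Suc n" using "0"(3)[of k] by (cases "k \<le> n") auto
  then show ?case by (auto simp: set_replicate_conv_if)
next
  case (Suc m)
  have tops: "map (\<lambda>j. {i \<in> {1..n}. mu i = j}) (rev [0..<Suc m]) =
      {i \<in> {1..n}. mu i = m} # map (\<lambda>j. {i \<in> {1..n}. mu i = j}) (rev [0..<m])"
    by (simp add: upt_Suc)
  have mem: "map Color (descending n j) @ replicate (j - 1) Plus
      \<in> {qs. set qs \<subseteq> labels n \<and> length qs = n}" if "1 \<le> j" "j \<le> Suc n" for j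
    using that by (auto simp: labels_def set_replicate_conv_if)
  show ?case
  proof (cases "k \<le> n \<and> mu k = m")
    case True
    have top: "{i \<in> {1..n}. mu i = m} = {k}"
    proof -
      have "i \<in> {i \<in> {1..n}. mu i = m} \<longleftrightarrow> i \<in> {k}" for i
        using mono[of i k] mono[of k i] True Suc.prems(1) by (cases i k rule: linorder_cases) auto
      then show ?thesis by blast
    qed
    have state: "map Color (descending n k) = map Color (descending n (Suc k)) @ [Color k]"
      using True by (simp add: descending_Suc)
    have "grid (labels n) xs (map Color (descending n k) @ replicate (k - 1) Plus)
        ({k} # map (\<lambda>j. {i \<in> {1..n}. mu i = j}) (rev [0..<m])) =
      prod_list (take (Suc n - Suc k) xs) *
        grid (labels n) xs (map Color (descending n (Suc k)) @ replicate (Suc k - 1) Plus)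
          (map (\<lambda>j. {i \<in> {1..n}. mu i = j}) (rev [0..<m]))"
    proof (rule sum_grid_eq_single[where n = n, OF finite_labels mem])
      fix qs :: "hlabel list" assume "length qs = n"
      then show "column xs (map Color (descending n k) @ replicate (k - 1) Plus) {k} qs =
        (if qs = map Color (descending n (Suc k)) @ replicate (Suc k - 1) Plus
         then prod_list (take (Suc n - Suc k) xs) else 0)"
        using column_singleton_top[of "descending n (Suc k)" k xs "k - 1" qs]
          True Suc.prems(1) assms(1)
        by (simp add: state)
    qed (use True Suc.prems in auto)
    also have "\<dots> = (\<Prod>c = Suc k..n. xs ! (n - c)) *
        (\<Prod>c = Suc k..n. xs ! (n - c) ^ (m - 1 - mu c))"
    proof -
      have "mu c < m" if "Suc k \<le> c" "c \<le> n" for c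
        using mono[of k c] that True Suc.prems(1) by auto
      moreover have "m \<le> mu c" if "1 \<le> c" "c < Suc k" for c
        using Suc.prems(4)[of c] that True by (cases "c = k") auto
      ultimately show ?thesis
        using True Suc.prems(1)
        by (subst prod_list_take_eq_prod[OF assms(1)], simp, subst Suc.IH) auto
    qed
    also have "\<dots> = (\<Prod>c = Suc k..n. xs ! (n - c) ^ (m - mu c))"
    proof -
      have "xs ! (n - c) * xs ! (n - c) ^ (m - 1 - mu c) = xs ! (n - c) ^ (m - mu c)"
        if "c \<in> {Suc k..n}" for c
      proof -
        have "mu c < m" using mono[of k c] that True Suc.prems(1) by auto
        then have "m - mu c = Suc (m - 1 - mu c)" by simp
        then show ?thesis by simp
      qed
      then show ?thesis by (simp add: prod.distrib[symmetric])
    qed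
    also have "\<dots> = (\<Prod>c = k..n. xs ! (n - c) ^ (m - mu c))"
      using True by (subst (2) prod.atLeast_Suc_atMost) auto
    finally show ?thesis by (simp only: tops top diff_Suc_1)
  next
    case False
    have less: "mu c < m" if "k \<le> c" "c \<le> n" for c
    proof (cases "c = k")
      case True
      then show ?thesis using Suc.prems(3)[of c] that False by auto
    next
      case 2: False
      then show ?thesis using mono[of k c] Suc.prems(1) Suc.prems(3)[of k] that False by force
    qed
    have top: "{i \<in> {1..n}. mu i = m} = {}"
    proof -
      have "mu i \<noteq> m" if "1 \<le> i" "i \<le> n" for i
        using less[of i] Suc.prems(4)[of i] that by (cases "k \<le> i") auto
      then show ?thesis by auto
    qed
    have "grid (labels n) xs (map Color (descending n k) @ replicate (k - 1) Plus)
        ({} # map (\<lambda>j. {i \<in> {1..n}. mu i = j}) (rev [0..<m])) =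
      prod_list (take (Suc n - k) xs) *
        grid (labels n) xs (map Color (descending n k) @ replicate (k - 1) Plus)
          (map (\<lambda>j. {i \<in> {1..n}. mu i = j}) (rev [0..<m]))"
    proof (rule sum_grid_eq_single[where n = n, OF finite_labels mem])
      fix qs :: "hlabel list" assume "length qs = n"
      then show "column xs (map Color (descending n k) @ replicate (k - 1) Plus) {} qs =
        (if qs = map Color (descending n k) @ replicate (k - 1) Plus
         then prod_list (take (Suc n - k) xs) else 0)"
        using column_empty_top[of xs "descending n k" "k - 1" qs] Suc.prems(1,2) assms(1)
        by simp
    qed (use Suc.prems in auto)
    also have "\<dots> = (\<Prod>c = k..n. xs ! (n - c)) *
        (\<Prod>c = k..n. xs ! (n - c) ^ (m - 1 - mu c))"
    proof -
      have "m \<le> mu c" if "1 \<le> c" "c < k" for c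
        using Suc.prems(4)[of c] that by auto
      then show ?thesis
        using less Suc.prems(1,2)
        by (subst prod_list_take_eq_prod[OF assms(1)], simp, subst Suc.IH) auto
    qed
    also have "\<dots> = (\<Prod>c = k..n. xs ! (n - c) ^ (m - mu c))"
    proof -
      have "xs ! (n - c) * xs ! (n - c) ^ (m - 1 - mu c) = xs ! (n - c) ^ (m - mu c)"
        if "c \<in> {k..n}" for c
      proof -
        have "m - mu c = Suc (m - 1 - mu c)" using less[of c] that by simp
        then show ?thesis by simp
      qed
      then show ?thesis by (simp add: prod.distrib[symmetric])
    qed
    finally show ?thesis by (simp only: tops top diff_Suc_1)
  qed
qed

end

section \<open>The Boltzmann weights as polynomials\<close>

lemma Const_1 [simp]: "Const (1 :: 'a::field) = 1"
  by (simp add: Const_def)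

lemma Const_add: "Const (c + d :: 'a::field) = Const c + Const d"
  by (simp add: Const_def single_add)

lemma Const_uminus: "Const (- c :: 'a::field) = - Const c"
  by (simp add: Const_def single_uminus)

lemma Const_diff: "Const (c - d :: 'a::field) = Const c - Const d"
  by (simp add: Const_def single_diff)

lemma Const_mult: "Const (c * d :: 'a::field) = Const c * Const d"
  by (simp add: Const_def mult_single)

lemma Const_power: "Const (c ^ k :: 'a::field) = Const c ^ k"
  by (induction k) (simp_all add: Const_mult)

lemmas Const_hom = Const_add Const_uminus Const_diff Const_mult Const_power

text \<open>
  The sequence \<open>v\<close> of the model.
\<close>

fun plus_seq :: "'a::field \<Rightarrow> 'a \<Rightarrow> 'a \<Rightarrow> nat \<Rightarrow> 'a" where
  "plus_seq \<alpha> \<beta> \<gamma> 0 = 1"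
| "plus_seq \<alpha> \<beta> \<gamma> (Suc 0) = \<gamma>"
| "plus_seq \<alpha> \<beta> \<gamma> (Suc (Suc k)) =
     - (\<alpha> + \<beta>) * plus_seq \<alpha> \<beta> \<gamma> (Suc k) - \<alpha> * \<beta> * plus_seq \<alpha> \<beta> \<gamma> k"

text \<open>
  At \<open>k = 0\<close> the recursion uses \<open>h\<^bsub>-1\<^esub> = 0\<close>.
\<close>

lemma hsym_rec:
  fixes \<alpha> \<beta> :: "'a::field"
  shows "hsym \<alpha> \<beta> (int k + 1) = (\<alpha> + \<beta>) * hsym \<alpha> \<beta> (int k) - \<alpha> * \<beta> * hsym \<alpha> \<beta> (int k - 1)"
proof -
  define H where "H k = (\<Sum>j\<le>k. \<alpha> ^ j * \<beta> ^ (k - j))" for k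
  have H_Suc: "H (Suc k) = \<beta> * H k + \<alpha> ^ Suc k" for k
  proof -
    have "(\<Sum>j\<le>k. \<alpha> ^ j * \<beta> ^ (Suc k - j)) = \<beta> * H k"
      unfolding H_def sum_distrib_left by (intro sum.cong) (auto simp: Suc_diff_le)
    then show ?thesis by (simp add: H_def)
  qed
  have h: "hsym \<alpha> \<beta> (int k) = H k" for k
    by (simp add: hsym_def H_def)
  show ?thesis
  proof (cases k)
    case 0
    then show ?thesis
      using h[of 1] H_Suc[of 0] by (simp add: hsym_def H_def)
  next
    case (Suc m)
    have "hsym \<alpha> \<beta> (int k + 1) = H (Suc (Suc m))" "hsym \<alpha> \<beta> (int k) = H (Suc m)"
      "hsym \<alpha> \<beta> (int k - 1) = H m"
      using h[of "Suc (Suc m)"] h[of "Suc m"] h[of m] Suc by (simp_all add: add.commute)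
    then show ?thesis by (simp add: H_Suc algebra_simps)
  qed
qed

lemma hsym_0: "hsym \<alpha> \<beta> 0 = 1" and hsym_minus_1: "hsym \<alpha> \<beta> (- 1) = 0"
  by (simp_all add: hsym_def)

lemma plus_seq_Suc:
  "plus_seq \<alpha> \<beta> \<gamma> (Suc k) =
     (- 1) ^ k * (\<gamma> * hsym \<alpha> \<beta> (int k) + \<alpha> * \<beta> * hsym \<alpha> \<beta> (int k - 1))"
proof (induction k rule: induct_nat_012)
  case 0
  then show ?case by (simp add: hsym_0 hsym_minus_1)
next
  case 1
  then show ?case
    using hsym_rec[of \<alpha> \<beta> 0] by (simp add: hsym_0 hsym_minus_1 algebra_simps)
next
  case (ge2 k)
  have h: "hsym \<alpha> \<beta> (int (Suc (Suc k))) =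
      (\<alpha> + \<beta>) * hsym \<alpha> \<beta> (int (Suc k)) - \<alpha> * \<beta> * hsym \<alpha> \<beta> (int k)"
    "hsym \<alpha> \<beta> (int (Suc k)) =
      (\<alpha> + \<beta>) * hsym \<alpha> \<beta> (int k) - \<alpha> * \<beta> * hsym \<alpha> \<beta> (int k - 1)"
    using hsym_rec[of \<alpha> \<beta> "Suc k"] hsym_rec[of \<alpha> \<beta> k] by (simp_all add: add.commute)
  have i: "int (Suc (Suc k)) - 1 = int (Suc k)" "int (Suc k) - 1 = int k"
    by simp_all
  show ?case
    by (simp only: plus_seq.simps(3)[of _ _ _ "Suc k"] ge2 i h power_Suc) algebra
qed

text \<open>
  The convention \<open>\<alpha>\<beta>h\<^bsub>-2\<^esub> = -1\<close> is what makes this hold at \<open>s = 0\<close>.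
\<close>

lemma plus_seq_eq:
  "plus_seq \<alpha> \<beta> \<gamma> s =
     (- 1) ^ (s + 1) * (\<gamma> * hsym \<alpha> \<beta> (int s - 1) + ab_hsym \<alpha> \<beta> (int s - 2))"
proof (cases s)
  case 0
  then show ?thesis by (simp add: hsym_minus_1 ab_hsym_def)
next
  case (Suc k)
  have "int (Suc k) - 2 = int k - 1" by simp
  then show ?thesis
    by (simp only: Suc plus_seq_Suc ab_hsym_def) simp
qed

text \<open>
  The coefficient of \<open>x\<close> in the weight of \<open>(+, \<Sigma>, +, \<Sigma>)\<close>.
\<close>

lemma plus_seq_diff:
  "\<gamma> * plus_seq \<alpha> \<beta> \<gamma> s - plus_seq \<alpha> \<beta> \<gamma> (Suc s) =
     (- 1) ^ (s + 1) * ((\<alpha> + \<gamma>) * (\<beta> + \<gamma>) * hsym \<alpha> \<beta> (int s - 1))"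
proof (cases s)
  case 0
  then show ?thesis by (simp add: hsym_minus_1)
next
  case (Suc k)
  have h: "hsym \<alpha> \<beta> (int (Suc k)) =
      (\<alpha> + \<beta>) * hsym \<alpha> \<beta> (int k) - \<alpha> * \<beta> * hsym \<alpha> \<beta> (int k - 1)"
    using hsym_rec[of \<alpha> \<beta> k] by (simp add: add.commute)
  have i: "int (Suc k) - 1 = int k"
    by simp
  show ?thesis
    by (simp only: Suc plus_seq_Suc i h power_Suc Suc_eq_plus1[symmetric]) algebra
qed

lemma lattice_weights_Const:
  "lattice_weights (Const \<alpha>) (Const \<beta>) (Const \<gamma>) (\<lambda>k. Const (plus_seq \<alpha> \<beta> \<gamma> k))"
  by unfold_locales (simp_all add: Const_hom)

lemma above_Const: "above (Const (c :: 'a::field)) S d = Const (c ^ num_gt S d)"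
  by (simp add: above_def Const_power)

text \<open>
  For replacing a color by another, the model and \<open>wt\<close> count the larger colors in sets that differ by
  an element which is not counted.
\<close>

lemma num_gt_remove:
  assumes "finite S" "d \<le> c"
  shows "num_gt (insert d S) c = num_gt S c" "num_gt (S - {d}) c = num_gt S c"
proof -
  have "{s \<in> insert d S. s \<ge> c + 1} = {s \<in> S. s \<ge> c + 1}"
    "{s \<in> S - {d}. s \<ge> c + 1} = {s \<in> S. s \<ge> c + 1}"
    using assms(2) by auto
  then show "num_gt (insert d S) c = num_gt S c" "num_gt (S - {d}) c = num_gt S c"
    by (simp_all add: num_gt_def)
qed

context
  fixes \<alpha> \<beta> \<gamma> :: "'a::field"
begin

interpretation W: lattice_weights "Const \<alpha>" "Const \<beta>" "Const \<gamma>" "\<lambda>k. Const (plus_seq \<alpha> \<beta> \<gamma> k)"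
  by (rule lattice_weights_Const)

lemma boltzmann_eq_wt:
  assumes "finite S"
  shows "boltzmann \<alpha> \<beta> \<gamma> x p S q S' = (if S' = south p S q then W.wt x p S q else 0)"
proof (cases p)
  case p: Plus
  show ?thesis
  proof (cases q)
    case Plus
    have "(- 1) ^ (card S + 1) *
        ((Const ((\<alpha> + \<gamma>) * (\<beta> + \<gamma>)) * x + Const \<gamma>) * Const (hsym \<alpha> \<beta> (int (card S) - 1))
          + Const (ab_hsym \<alpha> \<beta> (int (card S) - 2))) =
        Const (\<gamma> * plus_seq \<alpha> \<beta> \<gamma> (card S) - plus_seq \<alpha> \<beta> \<gamma> (Suc (card S))) * x
        + Const (plus_seq \<alpha> \<beta> \<gamma> (card S))"
      by (subst plus_seq_diff, subst plus_seq_eq) (simp add: Const_hom algebra_simps)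
    then show ?thesis
      using p Plus by (simp add: Const_hom algebra_simps)
  next
    case (Color d)
    then show ?thesis
      using p by (auto simp: W.fa_def W.fb_def above_Const Const_hom above_def mult.assoc)
  qed
next
  case p: (Color c)
  show ?thesis
  proof (cases q)
    case Plus
    show ?thesis
    proof (cases "c \<in> S")
      case True
      then have "card S > 0" using assms card_gt_0_iff by blast
      then obtain s where s: "card S = Suc s" using gr0_implies_Suc by blast
      have eq: "(- 1) ^ card S * (- \<beta>) ^ num_gt S c *
          (ab_hsym \<alpha> \<beta> (int (card S) - 3) + \<gamma> * hsym \<alpha> \<beta> (int (card S) - 2)) =
          (- \<beta>) ^ num_gt S c * plus_seq \<alpha> \<beta> \<gamma> (card S - 1)"
        by (simp add: plus_seq_eq[of \<alpha> \<beta> \<gamma> s] s algebra_simps)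
      show ?thesis
        unfolding p Plus boltzmann.simps south.simps W.wt.simps eq
        using True by (simp add: above_def Const_hom)
    qed (use p Plus in auto)
  next
    case q: (Color d)
    show ?thesis
    proof (cases c d rule: linorder_cases)
      case less
      then have "num_gt (S - {c}) d = num_gt S d"
        using assms by (simp add: num_gt_remove)
      then show ?thesis
        using p q less by (auto simp: W.fa_def above_def Const_hom)
    next
      case equal
      then show ?thesis
        using p q by (auto simp: above_def Const_hom power_mult_distrib[symmetric])
    next
      case greater
      have "num_gt (insert d S - {c}) d = num_gt (S - {c}) d"
        using assms greater num_gt_remove(1)[of "S - {c}" d d] by (simp add: insert_Diff_if)
      then show ?thesis
        using p q greater by (auto simp: W.fb_def above_def Const_hom insert_Diff_if)
    qed
  qed
qed

end

section \<open>The partition function as a grid\<close>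

context lattice_weights
begin

text \<open>
  The sequence \<open>s\<close> lists the vertical labels of a column from top to bottom.
\<close>

lemma column_eq_prod:
  assumes "\<And>i. s (Suc i) = south (pf (Suc i)) (s i) (qf (Suc i))" "j \<le> n"
  shows "column (map xf [Suc j..<Suc n]) (map pf [Suc j..<Suc n]) (s j) (map qf [Suc j..<Suc n]) =
    (\<Prod>i = Suc j..n. wt (xf i) (pf i) (s (i - 1)) (qf i)) * of_bool (s n = {})"
  using assms(2)
proof (induction j rule: inc_induct)
  case base
  then show ?case by simp
next
  case (step j)
  have "[Suc j..<Suc n] = Suc j # [Suc (Suc j)..<Suc n]"
    using step.hyps by (simp add: upt_conv_Cons)
  moreover have "(\<Prod>i = Suc j..n. wt (xf i) (pf i) (s (i - 1)) (qf i)) =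
      wt (xf (Suc j)) (pf (Suc j)) (s j) (qf (Suc j)) *
      (\<Prod>i = Suc (Suc j)..n. wt (xf i) (pf i) (s (i - 1)) (qf i))"
    using step.hyps by (subst prod.atLeast_Suc_atMost) auto
  ultimately show ?case
    using step.IH assms(1)[of j] by (simp add: mult.assoc)
qed

end

definition horizontals ::
    "nat \<Rightarrow> nat \<Rightarrow> (nat \<Rightarrow> hlabel) \<Rightarrow> (nat \<times> nat \<Rightarrow> hlabel) set" where
  "horizontals n m left = {hor \<in> ({1..n} \<times> {0..m}) \<rightarrow>\<^sub>E labels n.
     (\<forall>i\<in>{1..n}. hor (i, m) = left i) \<and> (\<forall>i\<in>{1..n}. hor (i, 0) = Plus)}"

lemma finite_horizontals [simp]: "finite (horizontals n m left)"
proof (rule finite_subset)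
  show "horizontals n m left \<subseteq> ({1..n} \<times> {0..m}) \<rightarrow>\<^sub>E labels n"
    by (auto simp: horizontals_def)
qed (intro finite_PiE finite_SigmaI; simp)

abbreviation row_list :: "nat \<Rightarrow> (nat \<Rightarrow> 'x) \<Rightarrow> 'x list" where
  "row_list n f \<equiv> map f [Suc 0..<Suc n]"

context lattice_weights
begin

lemma sum_horizontals_0:
  "(\<Sum>hor\<in>horizontals n 0 left. 1 :: 'r) = of_bool (set (row_list n left) \<subseteq> {Plus})"
proof (cases "\<forall>i\<in>{1..n}. left i = Plus")
  case True
  have "horizontals n 0 left = {restrict (\<lambda>_. Plus) ({1..n} \<times> {0..0})}" (is "_ = {?h}")
  proof (intro equalityI subsetI)
    fix hor assume hor: "hor \<in> horizontals n 0 left"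
    then have PiE: "hor \<in> ({1..n} \<times> {0..0}) \<rightarrow>\<^sub>E labels n" and "\<forall>i\<in>{1..n}. hor (i, 0) = Plus"
      by (auto simp: horizontals_def)
    then have "hor = ?h"
      by (intro PiE_ext[OF PiE]) (auto simp: labels_def)
    then show "hor \<in> {?h}" by simp
  qed (use True in \<open>auto simp: horizontals_def labels_def\<close>)
  then show ?thesis using True by auto
next
  case False
  then have "horizontals n 0 left = {}" by (auto simp: horizontals_def)
  then show ?thesis using False by (auto simp: image_subset_iff)
qed

text \<open>
  Cutting off the leftmost column: the labels on its east side become the west boundary of the rest.
  The summand \<open>F\<close> is a function of the labels on the remaining cuts.
\<close>

lemma sum_horizontals_Suc:
  fixes F :: "(nat \<times> nat \<Rightarrow> hlabel) \<Rightarrow> 'r"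
  assumes F: "\<And>hor hor'. (\<And>i k. i \<in> {1..n} \<Longrightarrow> k \<le> m \<Longrightarrow> hor (i, k) = hor' (i, k)) \<Longrightarrow> F hor = F hor'"
    and left: "\<forall>i\<in>{1..n}. left i \<in> labels n"
    and qs: "set qs \<subseteq> labels n" "length qs = n"
  shows "(\<Sum>hor | hor \<in> horizontals n (Suc m) left \<and> row_list n (\<lambda>i. hor (i, m)) = qs. F hor) =
    (\<Sum>hor\<in>horizontals n m (\<lambda>i. qs ! (i - 1)). F hor)"
proof -
  define extend where "extend hor = (\<lambda>(i, k). if i \<in> {1..n} \<and> k = Suc m then left i else hor (i, k))"
    for hor :: "nat \<times> nat \<Rightarrow> hlabel"
  define cut where "cut hor = restrict hor ({1..n} \<times> {0..m})" for hor :: "nat \<times> nat \<Rightarrow> hlabel"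
  have row: "row_list n (\<lambda>i. hor (i, m)) = qs \<longleftrightarrow> (\<forall>i\<in>{1..n}. hor (i, m) = qs ! (i - 1))"
    for hor :: "nat \<times> nat \<Rightarrow> hlabel"
  proof
    assume "row_list n (\<lambda>i. hor (i, m)) = qs"
    then show "\<forall>i\<in>{1..n}. hor (i, m) = qs ! (i - 1)" by auto
  next
    assume "\<forall>i\<in>{1..n}. hor (i, m) = qs ! (i - 1)"
    then show "row_list n (\<lambda>i. hor (i, m)) = qs"
      using qs(2) by (intro nth_equalityI) auto
  qed
  have mem: "hor \<in> {hor. hor \<in> horizontals n (Suc m) left \<and> row_list n (\<lambda>i. hor (i, m)) = qs} \<longleftrightarrow>
      hor \<in> ({1..n} \<times> {0..Suc m}) \<rightarrow>\<^sub>E labels n \<and> (\<forall>i\<in>{1..n}. hor (i, Suc m) = left i) \<and>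
      (\<forall>i\<in>{1..n}. hor (i, 0) = Plus) \<and> (\<forall>i\<in>{1..n}. hor (i, m) = qs ! (i - 1))" for hor
    by (simp only: row mem_Collect_eq horizontals_def conj_assoc)
  have qs_labels: "qs ! (i - 1) \<in> labels n" if "i \<in> {1..n}" for i
    using nth_mem[of "i - 1" qs] qs that by auto
  show ?thesis
  proof (rule sum.reindex_bij_witness[of _ extend cut]; (unfold mem)?)
    fix hor assume h: "hor \<in> ({1..n} \<times> {0..Suc m}) \<rightarrow>\<^sub>E labels n \<and> (\<forall>i\<in>{1..n}. hor (i, Suc m) = left i) \<and>
      (\<forall>i\<in>{1..n}. hor (i, 0) = Plus) \<and> (\<forall>i\<in>{1..n}. hor (i, m) = qs ! (i - 1))"
    show "extend (cut hor) = hor"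
    proof
      fix e :: "nat \<times> nat"
      obtain i k where e: "e = (i, k)" by (cases e)
      show "extend (cut hor) e = hor e"
        using h unfolding e
        by (cases "i \<in> {1..n}"; cases "k \<le> m"; cases "k = Suc m")
          (auto simp: extend_def cut_def PiE_iff extensional_def)
    qed
    show "cut hor \<in> horizontals n m (\<lambda>i. qs ! (i - 1))"
      using h by (auto simp: cut_def horizontals_def PiE_iff)
    show "F (cut hor) = F hor"
      by (rule F) (auto simp: cut_def)
  next
    fix hor assume hor: "hor \<in> horizontals n m (\<lambda>i. qs ! (i - 1))"
    then show "cut (extend hor) = hor"
      by (auto simp: cut_def extend_def horizontals_def fun_eq_iff PiE_iff extensional_def restrict_def)
    have "extend hor \<in> ({1..n} \<times> {0..Suc m}) \<rightarrow>\<^sub>E labels n"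
      using hor left by (auto simp: extend_def horizontals_def PiE_iff extensional_def le_Suc_eq)
    then show "extend hor \<in> ({1..n} \<times> {0..Suc m}) \<rightarrow>\<^sub>E labels n \<and> (\<forall>i\<in>{1..n}. extend hor (i, Suc m) = left i) \<and>
      (\<forall>i\<in>{1..n}. extend hor (i, 0) = Plus) \<and> (\<forall>i\<in>{1..n}. extend hor (i, m) = qs ! (i - 1))"
      using hor by (auto simp: extend_def horizontals_def)
  qed
qed

lemma sum_horizontals_eq_grid:
  assumes "\<forall>i\<in>{1..n}. left i \<in> labels n"
  shows "(\<Sum>hor\<in>horizontals n m left. \<Prod>k<m.
      column xs (row_list n (\<lambda>i. hor (i, Suc k))) (tops k) (row_list n (\<lambda>i. hor (i, k)))) =
    grid (labels n) xs (row_list n left) (map tops (rev [0..<m]))"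
  using assms
proof (induction m arbitrary: left)
  case 0
  then show ?case using sum_horizontals_0[of n left] by simp
next
  case (Suc m)
  define col where "col hor k =
    column xs (row_list n (\<lambda>i. hor (i, Suc k))) (tops k) (row_list n (\<lambda>i. hor (i, k)))" for hor k
  let ?A = "{qs. set qs \<subseteq> labels n \<and> length qs = n}"
  have "(\<Sum>hor\<in>horizontals n (Suc m) left. \<Prod>k<Suc m. col hor k) =
      (\<Sum>qs\<in>?A. \<Sum>hor | hor \<in> horizontals n (Suc m) left \<and> row_list n (\<lambda>i. hor (i, m)) = qs.
        \<Prod>k<Suc m. col hor k)"
  proof (rule sum.group[symmetric])
    show "finite ?A" by (rule finite_lists_length_eq) simp
    show "(\<lambda>hor. row_list n (\<lambda>i. hor (i, m))) ` horizontals n (Suc m) left \<subseteq> ?A"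
      by (auto simp: horizontals_def PiE_iff)
  qed simp
  also have "\<dots> = (\<Sum>qs\<in>?A. column xs (row_list n left) (tops m) qs *
      grid (labels n) xs qs (map tops (rev [0..<m])))"
  proof (rule sum.cong[OF refl])
    fix qs assume qs: "qs \<in> ?A"
    have left_qs: "row_list n (\<lambda>i. qs ! (i - 1)) = qs"
      using qs by (intro nth_equalityI) auto
    have "(\<Sum>hor | hor \<in> horizontals n (Suc m) left \<and> row_list n (\<lambda>i. hor (i, m)) = qs.
          \<Prod>k<Suc m. col hor k) =
        (\<Sum>hor | hor \<in> horizontals n (Suc m) left \<and> row_list n (\<lambda>i. hor (i, m)) = qs.
          column xs (row_list n left) (tops m) qs * (\<Prod>k<m. col hor k))"
    proof (rule sum.cong[OF refl])
      fix hor
      assume hor: "hor \<in> {hor. hor \<in> horizontals n (Suc m) left \<and> row_list n (\<lambda>i. hor (i, m)) = qs}"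
      then have west: "row_list n (\<lambda>i. hor (i, Suc m)) = row_list n left"
        by (auto simp: horizontals_def)
      have east: "row_list n (\<lambda>i. hor (i, m)) = qs"
        using hor by blast
      have "col hor m = column xs (row_list n left) (tops m) qs"
        unfolding col_def west east ..
      then show "(\<Prod>k<Suc m. col hor k) = column xs (row_list n left) (tops m) qs * (\<Prod>k<m. col hor k)"
        by simp
    qed
    also have "\<dots> = column xs (row_list n left) (tops m) qs *
        (\<Sum>hor | hor \<in> horizontals n (Suc m) left \<and> row_list n (\<lambda>i. hor (i, m)) = qs.
          \<Prod>k<m. col hor k)"
      by (simp only: sum_distrib_left)
    also have "(\<Sum>hor | hor \<in> horizontals n (Suc m) left \<and> row_list n (\<lambda>i. hor (i, m)) = qs.
          \<Prod>k<m. col hor k) =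
        (\<Sum>hor\<in>horizontals n m (\<lambda>i. qs ! (i - 1)). \<Prod>k<m. col hor k)"
    proof (rule sum_horizontals_Suc[OF _ Suc.prems])
      fix hor hor' :: "nat \<times> nat \<Rightarrow> hlabel"
      assume eq: "\<And>i k. i \<in> {1..n} \<Longrightarrow> k \<le> m \<Longrightarrow> hor (i, k) = hor' (i, k)"
      have rows: "row_list n (\<lambda>i. hor (i, k)) = row_list n (\<lambda>i. hor' (i, k))" if "k \<le> m" for k
        using eq that by auto
      have "col hor k = col hor' k" if "k < m" for k
        unfolding col_def using rows[of k] rows[of "Suc k"] that by (simp only: less_imp_le Suc_leI)
      then show "(\<Prod>k<m. col hor k) = (\<Prod>k<m. col hor' k)"
        by simp
    qed (use qs in auto)
    also have "\<dots> = grid (labels n) xs qs (map tops (rev [0..<m]))"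
    proof -
      have "qs ! (i - 1) \<in> labels n" if "i \<in> {1..n}" for i
        using nth_mem[of "i - 1" qs] qs that by auto
      then show ?thesis
        unfolding col_def using Suc.IH[of "\<lambda>i. qs ! (i - 1)"] left_qs by simp
    qed
    finally show "(\<Sum>hor | hor \<in> horizontals n (Suc m) left \<and> row_list n (\<lambda>i. hor (i, m)) = qs.
          \<Prod>k<Suc m. col hor k) = column xs (row_list n left) (tops m) qs *
        grid (labels n) xs qs (map tops (rev [0..<m]))" .
  qed
  also have "\<dots> = grid (labels n) xs (row_list n left) (map tops (rev [0..<Suc m]))"
  proof -
    have "rev [0..<Suc m] = m # rev [0..<m]" by (simp add: upt_Suc)
    then show ?thesis by simp
  qed
  finally show ?case by (simp only: col_def)
qed

end

text \<open>
  The vertical labels that color conservation forces when the horizontal ones are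
  given.
\<close>

fun ver_labels :: "(nat \<Rightarrow> nat set) \<Rightarrow> (nat \<times> nat \<Rightarrow> hlabel) \<Rightarrow> nat \<Rightarrow> nat \<Rightarrow> nat set" where
  "ver_labels tops hor k 0 = tops k"
| "ver_labels tops hor k (Suc i) =
     south (hor (Suc i, Suc k)) (ver_labels tops hor k i) (hor (Suc i, k))"

lemma ver_labels_subset:
  assumes "hor \<in> ({1..n} \<times> {0..N + 1}) \<rightarrow>\<^sub>E labels n" "tops k \<subseteq> {1..n}" "k \<le> N" "i \<le> n"
  shows "ver_labels tops hor k i \<subseteq> {1..n}"
  using assms(4)
proof (induction i)
  case (Suc i)
  have "hor (Suc i, k) \<in> labels n"
    using assms Suc.prems by (auto simp: PiE_iff)
  then have "c \<in> {1..n}" if "hor (Suc i, k) = Color c" for c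
    using that by (auto simp: labels_def)
  then show ?case
    using Suc by (fastforce simp: mem_south split: if_splits)
qed (use assms(2) in simp)

context
  fixes \<alpha> \<beta> \<gamma> :: "'a::field"
begin

interpretation W: lattice_weights "Const \<alpha>" "Const \<beta>" "Const \<gamma>" "\<lambda>k. Const (plus_seq \<alpha> \<beta> \<gamma> k)"
  by (rule lattice_weights_Const)

text \<open>
  All vertical labelings but the forced one contain a vertex of weight \<open>0\<close>, and the forced
  one is admissible if its bottom labels are empty.
\<close>

lemma sum_verticals:
  assumes hor: "hor \<in> ({1..n} \<times> {0..N + 1}) \<rightarrow>\<^sub>E labels n" and tops: "\<And>k. tops k \<subseteq> {1..n}"
  defines "V \<equiv> {ver \<in> ({0..n} \<times> {0..N}) \<rightarrow>\<^sub>E Pow {1..n}.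
    (\<forall>k\<in>{0..N}. ver (0, k) = tops k) \<and> (\<forall>k\<in>{0..N}. ver (n, k) = {})}"
  shows "(\<Sum>ver\<in>V. \<Prod>i = 1..n. \<Prod>k = 0..N.
      boltzmann \<alpha> \<beta> \<gamma> (X i) (hor (i, k + 1)) (ver (i - 1, k)) (hor (i, k)) (ver (i, k))) =
    (\<Prod>k<Suc N. W.column (row_list n X) (row_list n (\<lambda>i. hor (i, Suc k))) (tops k)
      (row_list n (\<lambda>i. hor (i, k))))"
proof -
  define s where "s = ver_labels tops hor"
  define ver0 where "ver0 = restrict (\<lambda>(i, k). s k i) ({0..n} \<times> {0..N})"
  define P where "P = (\<Prod>i = 1..n. \<Prod>k = 0..N.
    W.wt (X i) (hor (i, Suc k)) (s k (i - 1)) (hor (i, k)))"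
  have s_0: "s k 0 = tops k" for k
    by (simp add: s_def)
  have s_Suc: "s k (Suc i) = south (hor (Suc i, Suc k)) (s k i) (hor (Suc i, k))" for k i
    by (simp add: s_def)
  have s_subset: "s k i \<subseteq> {1..n}" if "k \<le> N" "i \<le> n" for k i
    unfolding s_def by (rule ver_labels_subset[OF hor tops that])
  have ver0: "ver0 (i, k) = s k i" if "k \<le> N" "i \<le> n" for k i
    using that by (simp add: ver0_def)
  have ver0_PiE: "ver0 \<in> ({0..n} \<times> {0..N}) \<rightarrow>\<^sub>E Pow {1..n}"
    unfolding ver0_def restrict_PiE_iff
  proof
    fix e assume e: "e \<in> {0..n} \<times> {0..N}"
    then obtain i k where "e = (i, k)" "i \<le> n" "k \<le> N" by auto
    then show "(case e of (i, k) \<Rightarrow> s k i) \<in> Pow {1..n}"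
      using s_subset[of k i] by simp
  qed
  have finV: "finite V"
    by (rule finite_subset[of _ "({0..n} \<times> {0..N}) \<rightarrow>\<^sub>E Pow {1..n}"])
      (auto simp: V_def intro!: finite_PiE)
  have weight: "(\<Prod>i = 1..n. \<Prod>k = 0..N.
      boltzmann \<alpha> \<beta> \<gamma> (X i) (hor (i, k + 1)) (ver (i - 1, k)) (hor (i, k)) (ver (i, k))) =
      (if ver = ver0 then P else 0)" if "ver \<in> V" for ver
  proof -
    have V: "ver \<in> ({0..n} \<times> {0..N}) \<rightarrow>\<^sub>E Pow {1..n}" "\<And>k. k \<le> N \<Longrightarrow> ver (0, k) = tops k"
      using that by (auto simp: V_def)
    have finite_ver: "finite (ver (i, k))" if "i \<le> n" "k \<le> N" for i k
    proof -
      have "ver (i, k) \<in> Pow {1..n}" using V(1) that by (auto simp: PiE_iff)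
      then show ?thesis by (auto intro: finite_subset)
    qed
    show ?thesis
    proof (cases "\<forall>i\<in>{1..n}. \<forall>k\<in>{0..N}.
        ver (i, k) = south (hor (i, Suc k)) (ver (i - 1, k)) (hor (i, k))")
      case True
      have eq: "ver (i, k) = s k i" if "i \<le> n" "k \<le> N" for i k
        using that(1)
      proof (induction i)
        case 0
        then show ?case using V(2) that(2) by (simp add: s_0)
      next
        case (Suc i)
        then have "ver (Suc i, k) = south (hor (Suc i, Suc k)) (ver (i, k)) (hor (Suc i, k))"
          using True[rule_format, of "Suc i" k] that(2) by simp
        then show ?case using Suc by (simp add: s_Suc)
      qed
      have "ver = ver0"
        by (rule PiE_ext[OF V(1) ver0_PiE]) (auto simp: eq ver0)
      moreover have "(\<Prod>i = 1..n. \<Prod>k = 0..N.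
          boltzmann \<alpha> \<beta> \<gamma> (X i) (hor (i, k + 1)) (ver (i - 1, k)) (hor (i, k)) (ver (i, k))) = P"
        unfolding P_def
      proof (intro prod.cong refl)
        fix i k assume ik: "i \<in> {1..n}" "k \<in> {0..N}"
        then have "finite (ver (i - 1, k))" "ver (i - 1, k) = s k (i - 1)"
          by (auto intro!: finite_ver eq)
        then show "boltzmann \<alpha> \<beta> \<gamma> (X i) (hor (i, k + 1)) (ver (i - 1, k)) (hor (i, k)) (ver (i, k)) =
            W.wt (X i) (hor (i, Suc k)) (s k (i - 1)) (hor (i, k))"
          using True ik by (simp add: boltzmann_eq_wt)
      qed
      ultimately show ?thesis by simp
    next
      case False
      then obtain i k where ik: "i \<in> {1..n}" "k \<in> {0..N}"
        and ne: "ver (i, k) \<noteq> south (hor (i, Suc k)) (ver (i - 1, k)) (hor (i, k))" by blast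
      have "finite (ver (i - 1, k))" using ik by (intro finite_ver) auto
      then have "boltzmann \<alpha> \<beta> \<gamma> (X i) (hor (i, k + 1)) (ver (i - 1, k)) (hor (i, k)) (ver (i, k)) = 0"
        using ne by (simp add: boltzmann_eq_wt)
      then have "(\<Prod>i = 1..n. \<Prod>k = 0..N.
          boltzmann \<alpha> \<beta> \<gamma> (X i) (hor (i, k + 1)) (ver (i - 1, k)) (hor (i, k)) (ver (i, k))) = 0"
        using ik by (intro prod_zero bexI[of _ i] bexI[of _ k]) auto
      moreover have "ver \<noteq> ver0"
      proof
        assume "ver = ver0"
        then have "ver (i, k) = s k i" "ver (i - 1, k) = s k (i - 1)"
          using ik ver0[of k i] ver0[of k "i - 1"] by auto
        then show False
          using ne s_Suc[of k "i - 1"] ik by simp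
      qed
      ultimately show ?thesis by simp
    qed
  qed
  have ver0_V: "ver0 \<in> V \<longleftrightarrow> (\<forall>k\<in>{0..N}. s k n = {})"
    using ver0_PiE by (auto simp: V_def ver0 s_0)
  have "(\<Sum>ver\<in>V. \<Prod>i = 1..n. \<Prod>k = 0..N.
      boltzmann \<alpha> \<beta> \<gamma> (X i) (hor (i, k + 1)) (ver (i - 1, k)) (hor (i, k)) (ver (i, k))) =
      (\<Sum>ver\<in>V. if ver = ver0 then P else 0)"
    by (rule sum.cong[OF refl weight])
  also have "\<dots> = (if ver0 \<in> V then P else 0)"
    using finV by (simp add: sum.delta')
  also have "\<dots> = (\<Prod>k<Suc N. (\<Prod>i = 1..n. W.wt (X i) (hor (i, Suc k)) (s k (i - 1)) (hor (i, k)))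
      * of_bool (s k n = {}))"
  proof (cases "ver0 \<in> V")
    case True
    have "(\<Prod>k<Suc N. (\<Prod>i = 1..n. W.wt (X i) (hor (i, Suc k)) (s k (i - 1)) (hor (i, k)))
        * of_bool (s k n = {})) =
        (\<Prod>k = 0..N. \<Prod>i = 1..n. W.wt (X i) (hor (i, Suc k)) (s k (i - 1)) (hor (i, k)))"
      using True ver0_V by (intro prod.cong) auto
    also have "\<dots> = P"
      unfolding P_def by (rule prod.swap)
    finally show ?thesis using True by simp
  next
    case False
    then obtain k where "k \<in> {0..N}" "s k n \<noteq> {}" using ver0_V by blast
    then have "(\<Prod>k<Suc N. (\<Prod>i = 1..n. W.wt (X i) (hor (i, Suc k)) (s k (i - 1)) (hor (i, k)))
        * of_bool (s k n = {})) = 0"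
      by (intro prod_zero bexI[of _ k]) auto
    then show ?thesis using False by simp
  qed
  also have "\<dots> = (\<Prod>k<Suc N. W.column (row_list n X) (row_list n (\<lambda>i. hor (i, Suc k))) (tops k)
      (row_list n (\<lambda>i. hor (i, k))))"
  proof (intro prod.cong refl)
    fix k
    show "(\<Prod>i = 1..n. W.wt (X i) (hor (i, Suc k)) (s k (i - 1)) (hor (i, k))) * of_bool (s k n = {}) =
      W.column (row_list n X) (row_list n (\<lambda>i. hor (i, Suc k))) (tops k) (row_list n (\<lambda>i. hor (i, k)))"
      using W.column_eq_prod[of "s k" "\<lambda>i. hor (i, Suc k)" "\<lambda>i. hor (i, k)" 0 n X]
      by (simp add: s_Suc s_0)
  qed
  finally show ?thesis .
qed

text \<open>
  The vertical labels are summed out first; then the sum over the horizontal labels is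
  organized by columns.
\<close>

theorem partition_function_eq_grid:
  assumes "w permutes {1..n}"
  shows "partition_function \<alpha> \<beta> \<gamma> n N (system n N w mu) =
    W.grid (labels n) (row_list n X) (row_list n (\<lambda>i. Color (n + 1 - inv w i)))
      (map (\<lambda>k. {i \<in> {1..n}. mu i = k}) (rev [0..<Suc N]))"
proof -
  define left where "left i = Color (n + 1 - inv w i)" for i
  define tops where "tops k = {i \<in> {1..n}. mu i = k}" for k
  define V where "V = {ver \<in> ({0..n} \<times> {0..N}) \<rightarrow>\<^sub>E Pow {1..n}.
    (\<forall>k\<in>{0..N}. ver (0, k) = tops k) \<and> (\<forall>k\<in>{0..N}. ver (n, k) = {})}"
  have "system n N w mu = horizontals n (Suc N) left \<times> V"
    by (auto simp: system_def labelings_def horizontals_def V_def left_def tops_def labels_def)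
  then have "partition_function \<alpha> \<beta> \<gamma> n N (system n N w mu) =
      (\<Sum>hor\<in>horizontals n (Suc N) left. \<Sum>ver\<in>V. state_weight \<alpha> \<beta> \<gamma> n N (hor, ver))"
    by (simp add: partition_function_def sum.cartesian_product)
  also have "\<dots> = (\<Sum>hor\<in>horizontals n (Suc N) left. \<Prod>k<Suc N.
      W.column (row_list n X) (row_list n (\<lambda>i. hor (i, Suc k))) (tops k) (row_list n (\<lambda>i. hor (i, k))))"
  proof (rule sum.cong[OF refl])
    fix hor assume "hor \<in> horizontals n (Suc N) left"
    then have hor: "hor \<in> ({1..n} \<times> {0..N + 1}) \<rightarrow>\<^sub>E labels n"
      by (simp add: horizontals_def)
    have "tops k \<subseteq> {1..n}" for k
      by (auto simp: tops_def)
    from sum_verticals[OF hor this]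
    show "(\<Sum>ver\<in>V. state_weight \<alpha> \<beta> \<gamma> n N (hor, ver)) = (\<Prod>k<Suc N.
        W.column (row_list n X) (row_list n (\<lambda>i. hor (i, Suc k))) (tops k) (row_list n (\<lambda>i. hor (i, k))))"
      unfolding V_def state_weight_def case_prod_conv .
  qed
  also have "\<dots> = W.grid (labels n) (row_list n X) (row_list n left) (map tops (rev [0..<Suc N]))"
  proof (rule W.sum_horizontals_eq_grid)
    have "inv w i \<in> {1..n}" if "i \<in> {1..n}" for i
      using permutes_in_image[OF permutes_inv[OF assms], of i] that by blast
    then show "\<forall>i\<in>{1..n}. left i \<in> labels n"
      by (fastforce simp: left_def labels_def)
  qed
  finally show ?thesis unfolding left_def[abs_def] tops_def[abs_def] .
qed

end

section \<open>Exchanging two variables\<close>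

lemma poly_induct_add_single:
  fixes f :: "'a::field xpoly"
  assumes "P 0" "\<And>f m c. P f \<Longrightarrow> P (f + Poly_Mapping.single m c)"
  shows "P f"
proof (induction f rule: update_induct)
  case (update f m c)
  have "Poly_Mapping.update m c f = f + Poly_Mapping.single m c"
    using update(1)
    by (intro poly_mapping_eqI)
       (auto simp: lookup_add lookup_single lookup_update in_keys_iff when_def)
  then show ?case using assms(2) update(3) by simp
qed (rule assms(1))

text \<open>
  Both sides are additive in each factor, so it suffices to compare them on monomials.
\<close>

lemma swap_vars_mult: "swap_vars i (f * g) = swap_vars i f * swap_vars i g"
proof -
  have single_single: "swap_vars i (Poly_Mapping.single m c * Poly_Mapping.single k d) =
      swap_vars i (Poly_Mapping.single m c) * swap_vars i (Poly_Mapping.single k (d :: 'a))" for m c k d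
    by (simp add: mult_single swap_vars_single map_key_plus inj_transpose)
  have swap_0: "swap_vars i 0 = (0 :: 'a xpoly)"
    by (simp add: swap_vars_def map_key_zero[OF inj_map_key_transpose])
  have single: "swap_vars i (f * Poly_Mapping.single k d) =
      swap_vars i f * swap_vars i (Poly_Mapping.single k d)" for f :: "'a xpoly" and k d
    by (induction f rule: poly_induct_add_single)
      (simp_all add: swap_0 distrib_right swap_vars_add single_single)
  show ?thesis
    by (induction g rule: poly_induct_add_single)
      (simp_all add: swap_0 distrib_left swap_vars_add single)
qed

lemma swap_vars_Const: "swap_vars i (Const c) = Const (c :: 'a::field)"
  by (simp add: Const_def swap_vars_single map_key_zero inj_transpose)

lemma swap_vars_X: "swap_vars i (X j) = X (transpose i (i + 1) j)"
  using map_key_single[OF inj_transpose, of i "i + 1" "transpose i (i + 1) j" "1 :: nat"]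
  by (simp add: X_def swap_vars_single)

context
  fixes \<alpha> \<beta> \<gamma> :: "'a::field"
begin

interpretation W: lattice_weights "Const \<alpha>" "Const \<beta>" "Const \<gamma>" "\<lambda>k. Const (plus_seq \<alpha> \<beta> \<gamma> k)"
  by (rule lattice_weights_Const)

lemma swap_vars_grid:
  assumes "i < n" "1 \<le> i"
  shows "swap_vars i (W.grid L (row_list n X) ps Ss) = W.grid L (swap_at (i - 1) (row_list n X)) ps Ss"
proof -
  have "map (swap_vars i) (row_list n X) = swap_at (i - 1) (row_list n (X :: nat \<Rightarrow> 'a xpoly))"
    (is "?l = ?r")
  proof (rule nth_equalityI)
    fix k assume "k < length ?l"
    then have k: "k < n" by simp
    have "Suc (transpose (i - 1) (Suc (i - 1)) k) = transpose i (i + 1) (Suc k)"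
      using assms by (auto simp: transpose_def)
    moreover have "transpose (i - 1) (Suc (i - 1)) k < n"
      using assms k by (auto simp: transpose_def)
    ultimately show "?l ! k = ?r ! k"
      using k assms by (simp add: nth_swap_at swap_vars_X)
  qed simp
  then show ?thesis
    using swap_vars_Const[of i "1 :: 'a"]
    by (subst W.grid_hom) (simp_all add: swap_vars_add swap_vars_mult swap_vars_Const)
qed

text \<open>
  For \<open>d < c\<close> the relation of \<open>grid_exchange\<close> has the coefficients \<open>fa x * fb y\<close> and \<open>y - x\<close>.
  Since \<open>fa x * fb y\<close> exceeds \<open>rnorm x y\<close> by \<open>\<beta>(y - x)\<close>, the relation says that \<open>y - x\<close> times the claim
  holds, and \<open>y - x\<close> can be cancelled.
\<close>

theorem T_op_grid:
  assumes i: "1 \<le> i" "i < n" and ps: "length ps = n" "ps ! (i - 1) = Color c" "ps ! i = Color d" "d < c"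
    and fin: "finite L" "\<forall>S\<in>set Ss. finite S"
  shows "T_op \<alpha> \<beta> \<gamma> i (W.grid L (row_list n X) ps Ss) = W.grid L (row_list n X) (swap_at (i - 1) ps) Ss"
proof -
  let ?x = "X i :: 'a xpoly" and ?y = "X (i + 1) :: 'a xpoly"
  define F where "F = W.grid L (row_list n X) ps Ss"
  define G where "G = W.grid L (row_list n X) (swap_at (i - 1) ps) Ss"
  have "row_list n X ! (i - 1) = ?x" "row_list n X ! Suc (i - 1) = ?y"
    using i by (simp_all)
  then have exchange: "W.rnorm ?x ?y * swap_vars i F = W.fa ?x * W.fb ?y * F + (?y - ?x) * G"
    using W.grid_exchange[OF fin, of "i - 1" "row_list n X" ps] i ps
    by (simp add: swap_vars_grid F_def G_def)
  have quotient: "(?y - ?x) * divided_difference i F = swap_vars i F - F"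
    by (rule divided_difference_eq)
  have norm: "Const (\<alpha> + \<beta> + \<gamma>) * ?x + Const \<gamma> * ?y + 1 + Const ((\<beta> + \<gamma>) * (\<alpha> + \<gamma>)) * ?x * ?y = W.rnorm ?x ?y"
    by (simp add: W.rnorm_def Const_hom algebra_simps)
  have "(?y - ?x) * T_op \<alpha> \<beta> \<gamma> i F =
      - Const \<beta> * (?y - ?x) * F + W.rnorm ?x ?y * ((?y - ?x) * divided_difference i F)"
    unfolding T_op_def norm by (simp add: algebra_simps)
  also have "\<dots> = - Const \<beta> * (?y - ?x) * F + W.fa ?x * W.fb ?y * F + (?y - ?x) * G - W.rnorm ?x ?y * F"
    unfolding quotient right_diff_distrib exchange by simp
  also have "\<dots> = (?y - ?x) * G"
    unfolding W.rnorm_def W.fa_def W.fb_def by algebra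
  finally show ?thesis
    using X_diff_nonzero[of i, where 'a = 'a] by (simp add: F_def G_def)
qed

end


section \<open>Reduced words\<close>

lemma word_perm_Nil [simp]: "word_perm [] = id"
  and word_perm_Cons [simp]: "word_perm (i # is) = transpose i (i + 1) \<circ> word_perm is"
  by (simp_all add: word_perm_def)

lemma word_perm_append: "word_perm (is @ js) = word_perm is \<circ> word_perm js"
  by (induction "is") (simp_all add: comp_assoc)

lemma word_perm_permutes: "set is \<subseteq> {1..<n} \<Longrightarrow> word_perm is permutes {1..n}"
proof (induction "is")
  case (Cons i "is")
  then have "transpose i (i + 1) permutes {1..n}" by (intro permutes_swap_id) auto
  then show ?case
    unfolding word_perm_Cons using Cons by (intro permutes_compose) auto
qed (simp add: permutes_id)

lemma inj_word_perm: "inj (word_perm is)"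
proof (induction "is")
  case (Cons i "is")
  then show ?case
    unfolding word_perm_Cons by (intro inj_compose inj_transpose)
qed simp

text \<open>
  The values at \<open>a < b\<close> start in increasing order and end in decreasing order. A letter at
  which they change their order exchanges just these two values, and leaving it out
  amounts to exchanging \<open>a\<close> and \<open>b\<close> beforehand.
\<close>

lemma word_perm_delete_letter:
  assumes "a < b" "word_perm js b < word_perm js a"
  shows "\<exists>ks. set ks \<subseteq> set js \<and> length ks < length js \<and> word_perm ks = word_perm js \<circ> transpose a b"
  using assms(2)
proof (induction js)
  case (Cons j js)
  let ?v = "word_perm js"
  show ?case
  proof (cases "?v b < ?v a")
    case True
    then obtain ks where "set ks \<subseteq> set js" "length ks < length js"
      "word_perm ks = ?v \<circ> transpose a b"
      using Cons.IH by blast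
    then show ?thesis
      by (intro exI[of _ "j # ks"]) (auto simp: comp_assoc)
  next
    case False
    have inj: "?v x = ?v y \<longleftrightarrow> x = y" for x y
      using inj_word_perm by (simp add: inj_eq)
    have "?v a < ?v b"
      using False inj[of a b] assms(1) by (simp add: not_less le_less)
    then have v: "?v a = j" "?v b = j + 1"
      using Cons.prems by (auto simp: transpose_def split: if_splits)
    have eq: "word_perm js = word_perm (j # js) \<circ> transpose a b"
    proof
      fix x
      have "?v x \<noteq> j" if "x \<noteq> a" using inj[of x a] that v by simp
      moreover have "?v x \<noteq> j + 1" if "x \<noteq> b" using inj[of x b] that v by simp
      ultimately show "word_perm js x = (word_perm (j # js) \<circ> transpose a b) x"
        using v assms(1) by (cases "x = a"; cases "x = b") (auto simp: transpose_def)
    qed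
    show ?thesis
      by (intro exI[of _ js] conjI eq) auto
  qed
qed (use assms(1) in simp)

lemma reduced_word_tail:
  assumes "reduced_word n w (i # is)"
  shows "reduced_word n (word_perm is) is"
  unfolding reduced_word_def
proof (intro conjI allI impI)
  show "set is \<subseteq> {1..<n}" using assms by (simp add: reduced_word_def)
  fix js assume js: "set js \<subseteq> {1..<n} \<and> word_perm js = word_perm is"
  then have "set (i # js) \<subseteq> {1..<n} \<and> word_perm (i # js) = w"
    using assms by (auto simp: reduced_word_def)
  then have "length (i # is) \<le> length (i # js)"
    using assms unfolding reduced_word_def by blast
  then show "length is \<le> length js" by simp
qed simp

text \<open>
  Otherwise deleting a letter of \<open>is\<close> would give a word for \<open>w\<close> that is
  shorter than \<open>i # is\<close>.
\<close>

lemma reduced_word_ascent: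
  assumes "reduced_word n w (i # is)"
  shows "inv (word_perm is) i < inv (word_perm is) (i + 1)"
proof (rule ccontr)
  let ?v = "word_perm is"
  assume not_less: "\<not> ?thesis"
  have letters: "set (i # is) \<subseteq> {1..<n}" and w: "word_perm (i # is) = w"
    using assms by (simp_all add: reduced_word_def)
  have "?v permutes {1..n}" using letters by (intro word_perm_permutes) simp
  then have bij: "bij ?v" by (rule permutes_bij)
  define a b where "a = inv ?v (i + 1)" and "b = inv ?v i"
  have v: "?v a = i + 1" "?v b = i"
    using bij by (simp_all add: a_def b_def bij_is_surj surj_f_inv_f)
  then have "a < b" using not_less by (cases a b rule: linorder_cases) (auto simp: a_def b_def)
  then obtain ks where ks: "set ks \<subseteq> set is" "length ks < length is"
    "word_perm ks = ?v \<circ> transpose a b"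
    using word_perm_delete_letter[of a b "is"] v by auto
  have "?v \<circ> transpose a b = w"
    using transpose_comp_eq[OF bij, of i "i + 1"] w by (simp add: a_def b_def transpose_commute)
  then have "length (i # is) \<le> length ks"
    using assms ks(1,3) letters unfolding reduced_word_def by auto
  then show False using ks(2) by simp
qed

lemma transpose_is_word_perm:
  assumes "1 \<le> a" "a < b" "b \<le> n"
  shows "\<exists>is. set is \<subseteq> {1..<n} \<and> word_perm is = transpose a b"
proof -
  have "Suc a \<le> b" using assms(2) by simp
  then show ?thesis
    using assms(3)
  proof (induction b rule: dec_induct)
    case base
    then show ?case using assms(1) by (intro exI[of _ "[a]"]) auto
  next
    case (step b)
    then obtain "is" where "is": "set is \<subseteq> {1..<n}" "word_perm is = transpose a b"
      by auto
    have "transpose b (b + 1) \<circ> transpose a b \<circ> transpose b (b + 1) = transpose a (b + 1)"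
      using step.hyps by (auto simp: fun_eq_iff transpose_def)
    then have "word_perm ([b] @ is @ [b]) = transpose a (Suc b)"
      by (simp only: word_perm_append "is" word_perm_Cons word_perm_Nil comp_id comp_assoc
          Suc_eq_plus1)
    then show ?case
      using "is" step assms(1) by (intro exI[of _ "[b] @ is @ [b]"]) auto
  qed
qed

lemma permutes_is_word_perm:
  assumes "w permutes {1..n}"
  shows "\<exists>is. set is \<subseteq> {1..<n} \<and> word_perm is = w"
  using assms finite_atLeastAtMost
proof (induction w rule: permutes_induct)
  case id
  then show ?case by (intro exI[of _ "[]"]) simp
next
  case (swap a b p)
  then obtain ks where ks: "set ks \<subseteq> {1..<n}" "word_perm ks = p" by blast
  have "\<exists>is. set is \<subseteq> {1..<n} \<and> word_perm is = transpose a b"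
    using transpose_is_word_perm[of a b n] transpose_is_word_perm[of b a n] swap.hyps
    by (cases a b rule: linorder_cases) (auto simp: transpose_commute)
  then obtain "is" where "is": "set is \<subseteq> {1..<n}" "word_perm is = transpose a b"
    by blast
  then show ?case
    using ks by (intro exI[of _ "is @ ks"]) (auto simp: word_perm_append)
qed

lemma reduced_word_exists:
  assumes "w permutes {1..n}"
  shows "\<exists>is. reduced_word n w is"
proof -
  obtain is0 where "set is0 \<subseteq> {1..<n} \<and> word_perm is0 = w"
    using permutes_is_word_perm[OF assms] by blast
  from ex_has_least_nat[of "\<lambda>is. set is \<subseteq> {1..<n} \<and> word_perm is = w", OF this, of length]
  show ?thesis unfolding reduced_word_def by blast
qed

section \<open>Induction along a reduced word\<close>

lemma T_word_Nil [simp]: "T_word \<alpha> \<beta> \<gamma> [] = id"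
  and T_word_Cons [simp]: "T_word \<alpha> \<beta> \<gamma> (i # is) = T_op \<alpha> \<beta> \<gamma> i \<circ> T_word \<alpha> \<beta> \<gamma> is"
  by (simp_all add: T_word_def)

definition west_labels :: "nat \<Rightarrow> (nat \<Rightarrow> nat) \<Rightarrow> hlabel list" where
  "west_labels n w = row_list n (\<lambda>i. Color (n + 1 - inv w i))"

lemma length_west_labels [simp]: "length (west_labels n w) = n"
  by (simp add: west_labels_def)

lemma nth_west_labels: "k < n \<Longrightarrow> west_labels n w ! k = Color (n + 1 - inv w (Suc k))"
  by (simp add: west_labels_def)

lemma west_labels_id: "west_labels n id = map Color (descending n 1) @ replicate (1 - 1) Plus"
proof (rule nth_equalityI)
  fix k assume "k < length (west_labels n id)"
  then show "west_labels n id ! k = (map Color (descending n 1) @ replicate (1 - 1) Plus) ! k"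
    by (simp add: nth_west_labels descending_def rev_nth nth_append)
qed simp

lemma west_labels_transpose:
  assumes "bij w" "1 \<le> i" "i < n"
  shows "west_labels n (transpose i (i + 1) \<circ> w) = swap_at (i - 1) (west_labels n w)"
proof (rule nth_equalityI)
  fix k assume k: "k < length (west_labels n (transpose i (i + 1) \<circ> w))"
  have "inv (transpose i (i + 1) \<circ> w) = inv w \<circ> transpose i (i + 1)"
    using assms(1) by (simp add: o_inv_distrib)
  moreover have "Suc (transpose (i - 1) (Suc (i - 1)) k) = transpose i (i + 1) (Suc k)"
    using assms by (auto simp: transpose_def)
  moreover have "transpose (i - 1) (Suc (i - 1)) k < n"
    using assms k by (auto simp: transpose_def)
  ultimately show "west_labels n (transpose i (i + 1) \<circ> w) ! k = swap_at (i - 1) (west_labels n w) ! k"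
    using k assms by (simp add: nth_west_labels nth_swap_at)
qed simp

context
  fixes \<alpha> \<beta> \<gamma> :: "'a::field"
begin

interpretation W: lattice_weights "Const \<alpha>" "Const \<beta>" "Const \<gamma>" "\<lambda>k. Const (plus_seq \<alpha> \<beta> \<gamma> k)"
  by (rule lattice_weights_Const)

text \<open>
  The exponents match: color \<open>c = n + 1 - i\<close> enters in row \<open>i\<close>, and to the left of column
  \<open>lam c + n - c\<close> there are \<open>lam 1 - lam c + n - i\<close> columns.
\<close>

lemma grid_west_labels_id:
  assumes "is_partition n lam" "1 \<le> n"
  shows "W.grid (labels n) (row_list n X) (west_labels n id)
      (map (\<lambda>k. {i \<in> {1..n}. lam i + rho n i = k}) (rev [0..<Suc (lam 1 + n - 1)])) =
    (\<Prod>i = 1..n. X i ^ ((lam 1 - lam (n + 1 - i)) + (n - i)))"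
proof -
  have anti: "lam d \<le> lam c" if "1 \<le> c" "c \<le> d" "d \<le> n" for c d
    using assms(1) that by (simp add: is_partition_def)
  have "W.grid (labels n) (row_list n X) (west_labels n id)
      (map (\<lambda>k. {i \<in> {1..n}. lam i + rho n i = k}) (rev [0..<Suc (lam 1 + n - 1)])) =
    (\<Prod>c = 1..n. row_list n X ! (n - c) ^ (Suc (lam 1 + n - 1) - 1 - (lam c + rho n c)))"
    unfolding west_labels_id
  proof (rule W.grid_identity)
    fix c d assume "1 \<le> c" "c < d" "d \<le> n"
    then show "lam d + rho n d < lam c + rho n c"
      using anti[of c d] by (simp add: rho_def)
  next
    fix c assume "1 \<le> c" "c \<le> n"
    then show "lam c + rho n c < Suc (lam 1 + n - 1)"
      using anti[of 1 c] by (simp add: rho_def)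
  qed (simp_all)
  also have "\<dots> = (\<Prod>i = 1..n. X i ^ ((lam 1 - lam (n + 1 - i)) + (n - i)))"
  proof (rule prod.reindex_bij_witness[of _ "\<lambda>i. n + 1 - i" "\<lambda>c. n + 1 - c"])
    fix c assume c: "c \<in> {1..n}"
    have "row_list n X ! (n - c) = (X (n + 1 - c) :: 'a xpoly)"
      using c by (simp add: Suc_diff_le)
    moreover have "Suc (lam 1 + n - 1) - 1 - (lam c + rho n c) = (lam 1 - lam (n + 1 - (n + 1 - c))) + (n - (n + 1 - c))"
      using c anti[of 1 c] by (simp add: rho_def)
    ultimately show "(X (n + 1 - c) :: 'a xpoly) ^ ((lam 1 - lam (n + 1 - (n + 1 - c))) + (n - (n + 1 - c))) =
        row_list n X ! (n - c) ^ (Suc (lam 1 + n - 1) - 1 - (lam c + rho n c))"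
      by (simp only:)
  qed auto
  finally show ?thesis .
qed

text \<open>
  The west labels reverse the order of \<open>inv w\<close>, so an ascent of \<open>inv w\<close> is a larger color above a smaller
  one, as \<open>T_op_grid\<close> requires.
\<close>

lemma T_word_grid:
  assumes "reduced_word n w is" "\<forall>S\<in>set Ss. finite S"
  shows "T_word \<alpha> \<beta> \<gamma> is (W.grid (labels n) (row_list n X) (west_labels n id) Ss) =
    W.grid (labels n) (row_list n X) (west_labels n w) Ss"
  using assms(1)
proof (induction "is" arbitrary: w)
  case Nil
  then have "w = id" by (simp add: reduced_word_def)
  then show ?case by simp
next
  case (Cons i "is")
  let ?v = "word_perm is"
  have letters: "set (i # is) \<subseteq> {1..<n}" and w: "w = transpose i (i + 1) \<circ> ?v"
    using Cons.prems by (auto simp: reduced_word_def)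
  have i: "1 \<le> i" "i < n" using letters by auto
  have v: "?v permutes {1..n}" using letters by (intro word_perm_permutes) simp
  have "inv ?v (i + 1) \<in> {1..n}"
    using permutes_in_image[OF permutes_inv[OF v], of "i + 1"] i by simp
  then have ascent: "n + 1 - inv ?v (i + 1) < n + 1 - inv ?v i"
    using reduced_word_ascent[OF Cons.prems] by simp
  have "T_word \<alpha> \<beta> \<gamma> (i # is) (W.grid (labels n) (row_list n X) (west_labels n id) Ss) =
      T_op \<alpha> \<beta> \<gamma> i (W.grid (labels n) (row_list n X) (west_labels n ?v) Ss)"
    using Cons.IH[OF reduced_word_tail[OF Cons.prems]] by (simp only: T_word_Cons comp_apply)
  also have "\<dots> = W.grid (labels n) (row_list n X) (swap_at (i - 1) (west_labels n ?v)) Ss"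
    using ascent i by (intro T_op_grid) (simp_all add: nth_west_labels assms(2))
  also have "swap_at (i - 1) (west_labels n ?v) = west_labels n w"
    unfolding w using i permutes_bij[OF v] by (intro west_labels_transpose[symmetric])
  finally show ?case .
qed

end

theorem theorem2p3:
  fixes \<alpha> \<beta> \<gamma> :: "'a::field" and n :: nat and lam w :: "nat \<Rightarrow> nat"
  assumes "n \<ge> 1" and "is_partition n lam" and "w permutes {1..n}"
  shows "partition_function \<alpha> \<beta> \<gamma> n (lam 1 + n - 1)
           (system n (lam 1 + n - 1) w (\<lambda>i. lam i + rho n i))
         = KN \<alpha> \<beta> \<gamma> n w lam"
proof -
  interpret W: lattice_weights "Const \<alpha>" "Const \<beta>" "Const \<gamma>" "\<lambda>k. Const (plus_seq \<alpha> \<beta> \<gamma> k)"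
    by (rule lattice_weights_Const)
  let ?tops = "map (\<lambda>k. {i \<in> {1..n}. lam i + rho n i = k}) (rev [0..<Suc (lam 1 + n - 1)])"
  define word where "word = (SOME is. reduced_word n w is)"
  have "reduced_word n w word"
    unfolding word_def using reduced_word_exists[OF assms(3)] by (rule someI_ex)
  then have "W.grid (labels n) (row_list n X) (west_labels n w) ?tops =
      T_word \<alpha> \<beta> \<gamma> word (W.grid (labels n) (row_list n X) (west_labels n id) ?tops)"
    by (intro T_word_grid[symmetric]) auto
  also have "\<dots> = KN \<alpha> \<beta> \<gamma> n w lam"
    unfolding grid_west_labels_id[OF assms(2,1)] KN_def T_perm_def word_def ..
  finally show ?thesis
    using partition_function_eq_grid[OF assms(3), of \<alpha> \<beta> \<gamma> "lam 1 + n - 1" "\<lambda>i. lam i + rho n i"]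
    by (simp only: west_labels_def)
qed

end
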